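(* Let $T$ be a Hopf algebra with bijective antipode $S$, $A$ a braided-commutative left-right Yetter-Drinfeld $T$-module algebra, $A\sharp T$ the smash product algebra with multiplication $\mu$, and $\tau\colon A\sharp T\to A\sharp T$ the map $\tau(a\sharp t)=S(t)\,S^2(a_{[1]})\cdot a_{[0]}$. Let $U\in (A\sharp T)\otimes_{\bm k}(A\sharp T)$ be a product of finitely many distinguished generators, i.e. of elements of the set $\{x\otimes1,\ Sx_{[1]}\otimes x_{[0]}\mid x\in A\}\cup\Delta_T(T)$. Then $$\mu(\mathrm{id}\otimes\tau)(U)\in A\sharp1.$$
   Context: Let $\bm k$ be a field, $\otimes=\otimes_{\bm k}$, Sweedler notation $\Delta_T(t)=t_{(1)}\otimes t_{(2)}$. $T$ is a Hopf $\bm k$-algebra with coproduct $\Delta_T$, counit $\epsilon_T$ and bijective antipode $S$. A braided-commutative left-right Yetter-Drinfeld $T$-module algebra $A$ is a unital associative algebra with a left $T$-action $\blacktriangleright$ satisfying $t\blacktriangleright(ab)=(t_{(1)}\blacktriangleright a)(t_{(2)}\blacktriangleright b)$, $t\blacktriangleright1=\epsilon_T(t)1$, and a right $T$-coaction $a\mapsto a_{[0]}\otimes a_{[1]}$ which is an algebra morphism $A\to A\otimes T^{\mathrm{op}}$, such that $(t_{(1)}\blacktriangleright a_{[0]})\otimes t_{(2)}a_{[1]}=(t_{(2)}\blacktriangleright a)_{[0]}\otimes(t_{(2)}\blacktriangleright a)_{[1]}t_{(1)}$ and $x_{[0]}(x_{[1]}\blacktriangleright a)=ax$ for all $t\in T$,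 $a,x\in A$. $A\sharp T$ is $A\otimes T$ with product $(a\sharp t)(a'\sharp t')=a(t_{(1)}\blacktriangleright a')\sharp t_{(2)}t'$ and unit $1\sharp1$. The dot $\cdot$ is multiplication in $A\sharp T$; $A\cong A\sharp1$ and $T\cong1\sharp T$ are viewed as subalgebras, and $T\otimes T\subset (A\sharp T)\otimes(A\sharp T)$, so $\Delta_T(T)\subset(A\sharp T)\otimes(A\sharp T)$. Products in $(A\sharp T)\otimes(A\sharp T)$ are componentwise. *)

theory Defs
  imports Complex_Main "HOL-Library.Poly_Mapping"
begin

section \<open>Tensor products of vector spaces\<close>

text \<open>
  Vector spaces over a field \<open>'k\<close> are given, as in \<^theory>\<open>HOL.Vector_Spaces\<close>, by an explicit
  scalar multiplication on a type of class \<^class>\<open>ab_group_add\<close>. The free vector space on \<open>'x\<close>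
  is the type \<open>'x \<Rightarrow>\<^sub>0 'k\<close>, and \<open>free_eval s g\<close> is the linear extension of \<open>g\<close> to it.
\<close>

definition free_scale :: "'k::field \<Rightarrow> ('x \<Rightarrow>\<^sub>0 'k) \<Rightarrow> ('x \<Rightarrow>\<^sub>0 'k)" where
  "free_scale c p = Poly_Mapping.map ((*) c) p"

definition free_eval ::
  "('k::field \<Rightarrow> 'c \<Rightarrow> 'c::ab_group_add) \<Rightarrow> ('x \<Rightarrow> 'c) \<Rightarrow> ('x \<Rightarrow>\<^sub>0 'k) \<Rightarrow> 'c" where
  "free_eval s g p = (\<Sum>x\<in>Poly_Mapping.keys p. s (Poly_Mapping.lookup p x) (g x))"

abbreviation free_gen :: "'x \<Rightarrow> ('x \<Rightarrow>\<^sub>0 'k::field)" where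
  "free_gen x \<equiv> Poly_Mapping.single x 1"

definition tensor_relations ::
  "('k::field \<Rightarrow> 'a \<Rightarrow> 'a::ab_group_add) \<Rightarrow> ('k \<Rightarrow> 'b \<Rightarrow> 'b::ab_group_add) \<Rightarrow> ('a \<times> 'b \<Rightarrow>\<^sub>0 'k) set"
  where
  "tensor_relations sA sB =
     {free_gen (x + x', y) - free_gen (x, y) - free_gen (x', y) | x x' y. True} \<union>
     {free_gen (x, y + y') - free_gen (x, y) - free_gen (x, y') | x y y'. True} \<union>
     {free_gen (sA c x, y) - free_scale c (free_gen (x, y)) | c x y. True} \<union>
     {free_gen (x, sB c y) - free_scale c (free_gen (x, y)) | c x y. True}"

record ('k, 'a, 'b, 'c) tensor =
  tscale :: "'k \<Rightarrow> 'c \<Rightarrow> 'c"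
  tens :: "'a \<Rightarrow> 'b \<Rightarrow> 'c"

text \<open>
  The quotient of the free vector space on \<open>'a \<times> 'b\<close> by the span of the relations above depends
  on the two scalar multiplications and hence cannot be made a type constructor. Instead,
  \<open>tensor_product sA sB X\<close> says that the space \<open>'c\<close> together with the map \<open>tens X\<close> is (a copy of)
  this quotient, i.e. that the linear map \<open>(x, y) \<mapsto> tens X x y\<close> from the free vector space onto
  \<open>'c\<close> induces an isomorphism from the quotient.
\<close>

locale tensor_product =
  left: vector_space sA + right: vector_space sB + target: vector_space "tscale X"
  for sA :: "'k::field \<Rightarrow> 'a::ab_group_add \<Rightarrow> 'a"
    and sB :: "'k \<Rightarrow> 'b::ab_group_add \<Rightarrow> 'b"
    and X :: "('k, 'a, 'b, 'c::ab_group_add) tensor" +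
  assumes surj: "range (free_eval (tscale X) (\<lambda>(x, y). tens X x y)) = UNIV"
    and kernel: "{p. free_eval (tscale X) (\<lambda>(x, y). tens X x y) p = 0}
      = module.span free_scale (tensor_relations sA sB)"

definition bilinear_map ::
  "('k::field \<Rightarrow> 'a \<Rightarrow> 'a::ab_group_add) \<Rightarrow> ('k \<Rightarrow> 'b \<Rightarrow> 'b::ab_group_add)
    \<Rightarrow> ('k \<Rightarrow> 'd \<Rightarrow> 'd::ab_group_add) \<Rightarrow> ('a \<Rightarrow> 'b \<Rightarrow> 'd) \<Rightarrow> bool" where
  "bilinear_map sA sB sD \<beta> \<longleftrightarrow>
     (\<forall>y. Vector_Spaces.linear sA sD (\<lambda>x. \<beta> x y)) \<and> (\<forall>x. Vector_Spaces.linear sB sD (\<beta> x))"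

text \<open>
  The linear map on the tensor product induced by a bilinear map \<open>\<beta>\<close>. Applied to an element
  \<open>z = \<Sum> x\<^sub>i \<otimes> y\<^sub>i\<close> it yields \<open>\<Sum> \<beta> x\<^sub>i y\<^sub>i\<close>, so expressions in Sweedler notation are written as
  \<open>tensor_lift X s (\<lambda>t1 t2. \<dots> t1 \<dots> t2 \<dots>) (\<Delta> t)\<close>.
\<close>

definition tensor_lift ::
  "('k::field, 'a, 'b, 'c::ab_group_add) tensor \<Rightarrow> ('k \<Rightarrow> 'd \<Rightarrow> 'd::ab_group_add)
    \<Rightarrow> ('a \<Rightarrow> 'b \<Rightarrow> 'd) \<Rightarrow> 'c \<Rightarrow> 'd" where
  "tensor_lift X sD \<beta> =
     (THE f. Vector_Spaces.linear (tscale X) sD f \<and> (\<forall>x y. f (tens X x y) = \<beta> x y))"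

definition tensor_map ::
  "('k::field, 'a, 'b, 'c::ab_group_add) tensor \<Rightarrow> ('k, 'd, 'e, 'f::ab_group_add) tensor
    \<Rightarrow> ('a \<Rightarrow> 'd) \<Rightarrow> ('b \<Rightarrow> 'e) \<Rightarrow> 'c \<Rightarrow> 'f" where
  "tensor_map X Y f g = tensor_lift X (tscale Y) (\<lambda>x y. tens Y (f x) (g y))"

text \<open>
  The componentwise product \<open>(x \<otimes> y) (x' \<otimes> y') = m x x' \<otimes> n y y'\<close>.
\<close>

definition tensor_mult ::
  "('k::field, 'a, 'b, 'c::ab_group_add) tensor \<Rightarrow> ('a \<Rightarrow> 'a \<Rightarrow> 'a) \<Rightarrow> ('b \<Rightarrow> 'b \<Rightarrow> 'b)
    \<Rightarrow> 'c \<Rightarrow> 'c \<Rightarrow> 'c" where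
  "tensor_mult X m n z w =
     tensor_lift X (tscale X)
       (\<lambda>x y. tensor_lift X (tscale X) (\<lambda>x' y'. tens X (m x x') (n y y')) w) z"

lemma lookup_free_scale [simp]:
  "Poly_Mapping.lookup (free_scale c p) x = c * Poly_Mapping.lookup p x"
  unfolding free_scale_def by (transfer) (auto simp: when_def)

lemma vector_space_free_scale: "vector_space (free_scale :: 'k::field \<Rightarrow> ('x \<Rightarrow>\<^sub>0 'k) \<Rightarrow> _)"
  by unfold_locales
    (auto intro!: poly_mapping_eqI simp: lookup_add algebra_simps)

lemma free_eval_superset:
  assumes "vector_space s" "finite F" "Poly_Mapping.keys p \<subseteq> F"
  shows "free_eval s g p = (\<Sum>x\<in>F. s (Poly_Mapping.lookup p x) (g x))"
proof -
  interpret vector_space s by fact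
  show ?thesis unfolding free_eval_def
    by (rule sum.mono_neutral_left) (use assms in \<open>auto simp: in_keys_iff\<close>)
qed

lemma linear_free_eval:
  fixes s :: "'k::field \<Rightarrow> 'c::ab_group_add \<Rightarrow> 'c" and g :: "'x \<Rightarrow> 'c"
  assumes "vector_space s"
  shows "Vector_Spaces.linear free_scale s (free_eval s g)"
proof -
  interpret vs: vector_space s by fact
  interpret fr: vector_space "free_scale :: 'k \<Rightarrow> ('x \<Rightarrow>\<^sub>0 'k) \<Rightarrow> _" by (rule vector_space_free_scale)
  show ?thesis
  proof unfold_locales
    fix p q :: "'x \<Rightarrow>\<^sub>0 'k" and c :: 'k
    let ?F = "Poly_Mapping.keys p \<union> Poly_Mapping.keys q"
    have "Poly_Mapping.keys (p + q) \<subseteq> ?F" by (rule Poly_Mapping.keys_add)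
    then show "free_eval s g (p + q) = free_eval s g p + free_eval s g q"
      using assms by (simp add: free_eval_superset[where F = ?F] lookup_add
          vs.scale_left_distrib sum.distrib)
    have "Poly_Mapping.keys (free_scale c p) \<subseteq> Poly_Mapping.keys p"
      by (auto simp: in_keys_iff)
    then show "free_eval s g (free_scale c p) = s c (free_eval s g p)"
      using assms by (simp add: free_eval_superset[where F = "Poly_Mapping.keys p"]
          vs.scale_sum_right)
  qed
qed

lemma free_eval_gen [simp]:
  assumes "vector_space s"
  shows "free_eval s g (free_gen x) = g x"
proof -
  interpret vector_space s by fact
  show ?thesis by (simp add: free_eval_def)
qed

context tensor_product
begin

lemma free_eval_linear_image:
  assumes "Vector_Spaces.linear (tscale X) sD f"
  shows "f (free_eval (tscale X) g p) = free_eval sD (f \<circ> g) p"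
proof -
  interpret f: Vector_Spaces.linear "tscale X" sD f by fact
  show ?thesis unfolding free_eval_def by (simp add: f.sum f.scale)
qed

lemma relation_eval_0:
  assumes "r \<in> tensor_relations sA sB"
  shows "free_eval (tscale X) (\<lambda>(x, y). tens X x y) r = 0"
proof -
  interpret fr: vector_space "free_scale :: 'k \<Rightarrow> ('a \<times> 'b \<Rightarrow>\<^sub>0 'k) \<Rightarrow> _"
    by (rule vector_space_free_scale)
  show ?thesis using fr.span_base[OF assms] kernel by blast
qed

lemma bilinear_map_tens: "bilinear_map sA sB (tscale X) (tens X)"
proof -
  interpret e: Vector_Spaces.linear free_scale "tscale X" "free_eval (tscale X) (\<lambda>(x, y). tens X x y)"
    by (rule linear_free_eval) (rule target.vector_space_axioms)
  note ev = e.diff e.scale free_eval_gen[OF target.vector_space_axioms]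
  have "tens X (x + x') y = tens X x y + tens X x' y" for x x' y
    using relation_eval_0[of "free_gen (x + x', y) - free_gen (x, y) - free_gen (x', y)"]
    by (simp add: ev tensor_relations_def) (metis add.commute diff_diff_eq eq_iff_diff_eq_0)
  moreover have "tens X x (y + y') = tens X x y + tens X x y'" for x y y'
    using relation_eval_0[of "free_gen (x, y + y') - free_gen (x, y) - free_gen (x, y')"]
    by (simp add: ev tensor_relations_def) (metis add.commute diff_diff_eq eq_iff_diff_eq_0)
  moreover have "tens X (sA c x) y = tscale X c (tens X x y)" for c x y
  proof -
    have "free_gen (sA c x, y) - free_scale c (free_gen (x, y)) \<in> tensor_relations sA sB"
      unfolding tensor_relations_def by blast
    from relation_eval_0[OF this] show ?thesis by (simp add: ev)
  qed
  moreover have "tens X x (sB c y) = tscale X c (tens X x y)" for c x y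
  proof -
    have "free_gen (x, sB c y) - free_scale c (free_gen (x, y)) \<in> tensor_relations sA sB"
      unfolding tensor_relations_def by blast
    from relation_eval_0[OF this] show ?thesis by (simp add: ev)
  qed
  ultimately show ?thesis
    unfolding bilinear_map_def by (auto intro!: Vector_Spaces.linear.intro module_hom.intro
        module_hom_axioms.intro left.vector_space_axioms right.vector_space_axioms
        target.vector_space_axioms left.module_axioms right.module_axioms target.module_axioms)
qed

lemma linear_eqI:
  assumes "Vector_Spaces.linear (tscale X) sD f" "Vector_Spaces.linear (tscale X) sD g"
    and "\<And>x y. f (tens X x y) = g (tens X x y)"
  shows "f = g"
proof
  fix z
  obtain p where z: "z = free_eval (tscale X) (\<lambda>(x, y). tens X x y) p"
    using surj by (metis UNIV_I imageE)
  have "f \<circ> (\<lambda>(x, y). tens X x y) = g \<circ> (\<lambda>(x, y). tens X x y)"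
    using assms(3) by auto
  then show "f z = g z"
    unfolding z free_eval_linear_image[OF assms(1)] free_eval_linear_image[OF assms(2)] by simp
qed

theorem universal_property:
  assumes D: "vector_space sD" and bil: "bilinear_map sA sB sD \<beta>"
  shows "\<exists>!f. Vector_Spaces.linear (tscale X) sD f \<and> (\<forall>x y. f (tens X x y) = \<beta> x y)"
proof -
  interpret D: vector_space sD by fact
  interpret fr: vector_space "free_scale :: 'k \<Rightarrow> ('a \<times> 'b \<Rightarrow>\<^sub>0 'k) \<Rightarrow> _"
    by (rule vector_space_free_scale)
  define e where "e = free_eval (tscale X) (\<lambda>(x, y). tens X x y)"
  define d where "d = free_eval sD (\<lambda>(x, y). \<beta> x y)"
  interpret e: Vector_Spaces.linear free_scale "tscale X" e
    unfolding e_def by (rule linear_free_eval) (rule target.vector_space_axioms)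
  interpret d: Vector_Spaces.linear free_scale sD d
    unfolding d_def by (rule linear_free_eval) (rule D)
  have d_gen: "d (free_gen (x, y)) = \<beta> x y" for x y
    unfolding d_def by (simp add: free_eval_gen[OF D])
  have e_gen: "e (free_gen (x, y)) = tens X x y" for x y
    unfolding e_def by (simp add: free_eval_gen[OF target.vector_space_axioms])
  have lin1: "module_hom sA sD (\<lambda>x. \<beta> x y)" and lin2: "module_hom sB sD (\<beta> x)" for x y
    using bil unfolding bilinear_map_def by (auto dest: Vector_Spaces.linear.axioms)
  have "tensor_relations sA sB \<subseteq> {p. d p = 0}"
    unfolding tensor_relations_def
    by (auto simp: d.diff d.scale d_gen module_hom.add[OF lin1] module_hom.add[OF lin2]
        module_hom.scale[OF lin1] module_hom.scale[OF lin2])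
  then have "fr.span (tensor_relations sA sB) \<subseteq> {p. d p = 0}"
    by (rule fr.span_minimal) (rule d.subspace_kernel)
  then have ker: "e p = 0 \<Longrightarrow> d p = 0" for p
    using kernel unfolding e_def by blast
  have surj': "\<exists>p. e p = z" for z
    using surj unfolding e_def by (metis UNIV_I imageE)
  define f where "f z = d (SOME p. e p = z)" for z
  have f_e: "f (e p) = d p" for p
  proof -
    have "e (SOME q. e q = e p) = e p" by (rule someI) simp
    then have "e ((SOME q. e q = e p) - p) = 0" by (simp add: e.diff)
    from ker[OF this] show ?thesis unfolding f_def by (simp add: d.diff)
  qed
  have "Vector_Spaces.linear (tscale X) sD f"
  proof unfold_locales
    fix z w c
    obtain p q where "e p = z" "e q = w" using surj' by blast
    then show "f (z + w) = f z + f w" "f (tscale X c z) = sD c (f z)"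
      by (metis d.add d.scale e.add e.scale f_e)+
  qed
  moreover have "f (tens X x y) = \<beta> x y" for x y
    using f_e[of "free_gen (x, y)"] by (simp add: e_gen d_gen)
  ultimately show ?thesis by (intro ex1I[of _ f]) (auto intro: linear_eqI)
qed

lemma linear_tensor_lift:
  assumes "vector_space sD" "bilinear_map sA sB sD \<beta>"
  shows "Vector_Spaces.linear (tscale X) sD (tensor_lift X sD \<beta>)"
  using theI'[OF universal_property[OF assms]] unfolding tensor_lift_def by blast

lemma tensor_lift_tens:
  assumes "vector_space sD" "bilinear_map sA sB sD \<beta>"
  shows "tensor_lift X sD \<beta> (tens X x y) = \<beta> x y"
  using theI'[OF universal_property[OF assms]] unfolding tensor_lift_def by blast

end


section \<open>Algebras and Hopf algebras\<close>

text \<open>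
  The sort \<open>{ring, monoid_mult}\<close> is that of unital associative rings without the requirement
  \<open>0 \<noteq> 1\<close> of \<^class>\<open>ring_1\<close>, so that the zero algebra is included.
\<close>

locale k_algebra = vector_space s
  for s :: "'k::field \<Rightarrow> 'a::{ring, monoid_mult} \<Rightarrow> 'a" +
  assumes scale_mult_left: "s c x * y = s c (x * y)"
    and scale_mult_right: "x * s c y = s c (x * y)"

text \<open>
  \<open>tensor2\<close> is \<open>T \<otimes> T\<close> and \<open>tensor3\<close> is \<open>(T \<otimes> T) \<otimes> T\<close>.
\<close>

record ('k, 't, 'tt, 'ttt) hopf =
  hscale :: "'k \<Rightarrow> 't \<Rightarrow> 't"
  tensor2 :: "('k, 't, 't, 'tt) tensor"
  tensor3 :: "('k, 'tt, 't, 'ttt) tensor"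
  comult :: "'t \<Rightarrow> 'tt"
  counit :: "'t \<Rightarrow> 'k"
  antipode :: "'t \<Rightarrow> 't"

text \<open>
  In \<open>coassoc\<close> the right hand side is \<open>(id \<otimes> \<Delta>) \<circ> \<Delta>\<close>, moved to \<open>(T \<otimes> T) \<otimes> T\<close> by the
  associativity isomorphism.
\<close>

locale hopf_algebra =
  k_algebra "hscale T" +
  T2: tensor_product "hscale T" "hscale T" "tensor2 T" +
  T3: tensor_product "tscale (tensor2 T)" "hscale T" "tensor3 T"
  for T :: "('k::field, 't::{ring, monoid_mult}, 'tt::ab_group_add, 'ttt::ab_group_add) hopf" +
  assumes comult_linear: "Vector_Spaces.linear (hscale T) (tscale (tensor2 T)) (comult T)"
    and counit_linear: "Vector_Spaces.linear (hscale T) (*) (counit T)"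
    and coassoc:
      "tensor_map (tensor2 T) (tensor3 T) (comult T) id (comult T t) =
       tensor_lift (tensor2 T) (tscale (tensor3 T))
         (\<lambda>t1 t2. tensor_lift (tensor2 T) (tscale (tensor3 T))
           (\<lambda>u v. tens (tensor3 T) (tens (tensor2 T) t1 u) v) (comult T t2))
         (comult T t)"
    and counit_left:
      "tensor_lift (tensor2 T) (hscale T) (\<lambda>t1 t2. hscale T (counit T t1) t2) (comult T t) = t"
    and counit_right:
      "tensor_lift (tensor2 T) (hscale T) (\<lambda>t1 t2. hscale T (counit T t2) t1) (comult T t) = t"
    and comult_mult:
      "comult T (t * u) = tensor_mult (tensor2 T) (*) (*) (comult T t) (comult T u)"
    and comult_one: "comult T 1 = tens (tensor2 T) 1 1"
    and counit_mult: "counit T (t * u) = counit T t * counit T u"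
    and counit_one: "counit T 1 = 1"
    and antipode_linear: "Vector_Spaces.linear (hscale T) (hscale T) (antipode T)"
    and antipode_left:
      "tensor_lift (tensor2 T) (hscale T) (\<lambda>t1 t2. antipode T t1 * t2) (comult T t)
        = hscale T (counit T t) 1"
    and antipode_right:
      "tensor_lift (tensor2 T) (hscale T) (\<lambda>t1 t2. t1 * antipode T t2) (comult T t)
        = hscale T (counit T t) 1"


section \<open>Braided-commutative left-right Yetter-Drinfeld module algebras\<close>

text \<open>
  \<open>AT\<close> is \<open>A \<otimes> T\<close> and \<open>ATT\<close> is \<open>(A \<otimes> T) \<otimes> T\<close>.
\<close>

record ('k, 't, 'a, 'at, 'att) yd_data =
  ascale :: "'k \<Rightarrow> 'a \<Rightarrow> 'a"
  AT :: "('k, 'a, 't, 'at) tensor"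
  ATT :: "('k, 'at, 't, 'att) tensor"
  act :: "'t \<Rightarrow> 'a \<Rightarrow> 'a"
  coact :: "'a \<Rightarrow> 'at"

locale braided_commutative_yd_module_algebra =
  hopf_algebra T +
  A: k_algebra "ascale A" +
  AT: tensor_product "ascale A" "hscale T" "AT A" +
  ATT: tensor_product "tscale (AT A)" "hscale T" "ATT A"
  for T :: "('k::field, 't::{ring, monoid_mult}, 'tt::ab_group_add, 'ttt::ab_group_add) hopf"
    and A :: "('k, 't, 'a::{ring, monoid_mult}, 'at::ab_group_add, 'att::ab_group_add) yd_data" +
  assumes act_bilinear: "bilinear_map (hscale T) (ascale A) (ascale A) (act A)"
    and act_mult: "act A (t * u) a = act A t (act A u a)"
    and act_one: "act A 1 a = a"
    and act_product:
      "act A t (a * b) =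
       tensor_lift (tensor2 T) (ascale A) (\<lambda>t1 t2. act A t1 a * act A t2 b) (comult T t)"
    and act_unit: "act A t 1 = ascale A (counit T t) 1"
    and coact_linear: "Vector_Spaces.linear (ascale A) (tscale (AT A)) (coact A)"
    and coact_coassoc:
      "tensor_map (AT A) (ATT A) (coact A) id (coact A a) =
       tensor_lift (AT A) (tscale (ATT A))
         (\<lambda>a0 a1. tensor_lift (tensor2 T) (tscale (ATT A))
           (\<lambda>u v. tens (ATT A) (tens (AT A) a0 u) v) (comult T a1))
         (coact A a)"
    and coact_counit:
      "tensor_lift (AT A) (ascale A) (\<lambda>a0 a1. ascale A (counit T a1) a0) (coact A a) = a"
    and coact_product: \<comment> \<open>the product of \<open>A \<otimes> T\<^sup>o\<^sup>p\<close>\<close>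
      "coact A (a * b) = tensor_mult (AT A) (*) (\<lambda>t u. u * t) (coact A a) (coact A b)"
    and coact_unit: "coact A 1 = tens (AT A) 1 1"
    and yetter_drinfeld:
      "tensor_lift (tensor2 T) (tscale (AT A))
         (\<lambda>t1 t2. tensor_lift (AT A) (tscale (AT A))
           (\<lambda>a0 a1. tens (AT A) (act A t1 a0) (t2 * a1)) (coact A a))
         (comult T t) =
       tensor_lift (tensor2 T) (tscale (AT A))
         (\<lambda>t1 t2. tensor_lift (AT A) (tscale (AT A))
           (\<lambda>b0 b1. tens (AT A) b0 (b1 * t1)) (coact A (act A t2 a)))
         (comult T t)"
    and braided_commutative:
      "tensor_lift (AT A) (ascale A) (\<lambda>x0 x1. x0 * act A x1 a) (coact A x) = a * x"


section \<open>The smash product algebra and the distinguished generators\<close>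

text \<open>
  The smash product has underlying vector space \<open>A \<otimes> T\<close>, so \<open>a \<sharp> t\<close> is \<open>tens (AT A) a t\<close>.
\<close>

definition smash_mult ::
  "('k::field, 't::{ring, monoid_mult}, 'tt::ab_group_add, 'ttt) hopf
    \<Rightarrow> ('k, 't, 'a::{ring, monoid_mult}, 'at::ab_group_add, 'att) yd_data \<Rightarrow> 'at \<Rightarrow> 'at \<Rightarrow> 'at" where
  "smash_mult T A g h =
     tensor_lift (AT A) (tscale (AT A))
       (\<lambda>a t. tensor_lift (AT A) (tscale (AT A))
         (\<lambda>a' t'. tensor_lift (tensor2 T) (tscale (AT A))
           (\<lambda>t1 t2. tens (AT A) (a * act A t1 a') (t2 * t')) (comult T t)) h) g"

definition smash_one :: "('k, 't::monoid_mult, 'a::monoid_mult, 'at, 'att) yd_data \<Rightarrow> 'at" where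
  "smash_one A = tens (AT A) 1 1"

definition incl_A :: "('k, 't::monoid_mult, 'a, 'at, 'att) yd_data \<Rightarrow> 'a \<Rightarrow> 'at" where
  "incl_A A a = tens (AT A) a 1"

definition incl_T :: "('k, 't, 'a::monoid_mult, 'at, 'att) yd_data \<Rightarrow> 't \<Rightarrow> 'at" where
  "incl_T A t = tens (AT A) 1 t"

definition tau ::
  "('k::field, 't::{ring, monoid_mult}, 'tt::ab_group_add, 'ttt) hopf
    \<Rightarrow> ('k, 't, 'a::{ring, monoid_mult}, 'at::ab_group_add, 'att) yd_data \<Rightarrow> 'at \<Rightarrow> 'at" where
  "tau T A =
     tensor_lift (AT A) (tscale (AT A))
       (\<lambda>a t. tensor_lift (AT A) (tscale (AT A))
         (\<lambda>a0 a1. smash_mult T A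
            (incl_T A (antipode T t * antipode T (antipode T a1))) (incl_A A a0)) (coact A a))"

text \<open>
  In the following, \<open>HH\<close> is the tensor square of the smash product.
\<close>

definition smash_mu ::
  "('k::field, 't::{ring, monoid_mult}, 'tt::ab_group_add, 'ttt) hopf
    \<Rightarrow> ('k, 't, 'a::{ring, monoid_mult}, 'at::ab_group_add, 'att) yd_data
    \<Rightarrow> ('k, 'at, 'at, 'hh::ab_group_add) tensor \<Rightarrow> 'hh \<Rightarrow> 'at" where
  "smash_mu T A HH = tensor_lift HH (tscale (AT A)) (smash_mult T A)"

definition distinguished_generators ::
  "('k::field, 't::{ring, monoid_mult}, 'tt::ab_group_add, 'ttt) hopf
    \<Rightarrow> ('k, 't, 'a::{ring, monoid_mult}, 'at::ab_group_add, 'att) yd_data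
    \<Rightarrow> ('k, 'at, 'at, 'hh::ab_group_add) tensor \<Rightarrow> 'hh set" where
  "distinguished_generators T A HH =
     {tens HH (incl_A A x) (smash_one A) | x. True} \<union>
     {tensor_lift (AT A) (tscale HH)
        (\<lambda>x0 x1. tens HH (incl_T A (antipode T x1)) (incl_A A x0)) (coact A x) | x. True} \<union>
     {tensor_map (tensor2 T) HH (incl_T A) (incl_T A) (comult T t) | t. True}"

definition product_in_square ::
  "('k::field, 't::{ring, monoid_mult}, 'tt::ab_group_add, 'ttt) hopf
    \<Rightarrow> ('k, 't, 'a::{ring, monoid_mult}, 'at::ab_group_add, 'att) yd_data
    \<Rightarrow> ('k, 'at, 'at, 'hh::ab_group_add) tensor \<Rightarrow> 'hh list \<Rightarrow> 'hh" where
  "product_in_square T A HH us =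
     foldr (tensor_mult HH (smash_mult T A) (smash_mult T A)) us
       (tens HH (smash_one A) (smash_one A))"

end

theory Submission
  imports Defs
begin

text \<open>
  Write \<open>\<nu> (g \<otimes> h) = g \<cdot> \<tau> h\<close>. If \<open>\<tau> (y h) = \<tau> h \<cdot> \<tau> y\<close> for the second legs \<open>y\<close> of the distinguished
  generators, then \<open>\<nu> ((x \<otimes> y) U) = x \<cdot> \<nu> U \<cdot> \<tau> y\<close>, and by induction on the number of factors we may
  take \<open>\<nu> U = a \<in> A\<close>. The three kinds of generators then give \<open>x a\<close>, \<open>(S x\<^sub>[\<^sub>1\<^sub>] \<triangleright> a) x\<^sub>[\<^sub>0\<^sub>]\<close> and
  \<open>t\<^sub>(\<^sub>1\<^sub>) a S t\<^sub>(\<^sub>2\<^sub>) = t \<triangleright> a\<close>, all in \<open>A\<close>.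

  The element \<open>\<tau> x\<close> commutes with \<open>A\<close> for \<open>x \<in> A\<close>, because \<open>\<tau> x = \<beta> (S\<^sup>2 x\<^sub>[\<^sub>1\<^sub>] \<triangleright> x\<^sub>[\<^sub>0\<^sub>])\<close> for the
  target map \<open>\<beta> y = y\<^sub>[\<^sub>0\<^sub>] \<cdot> y\<^sub>[\<^sub>1\<^sub>]\<close>, whose values commute with \<open>A\<close> by braided commutativity; this gives
  antimultiplicativity for \<open>y \<in> A\<close>. For \<open>y \<in> T\<close> the Yetter-Drinfeld condition is used at \<open>t = S w\<close>,
  where it can be solved for the coaction of \<open>S w \<triangleright> a\<close> without \<open>S\<^sup>-\<^sup>1\<close>.
\<close>

section \<open>Sums over tensors\<close>

abbreviation lin where "lin \<equiv> Vector_Spaces.linear"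

section \<open>Linear maps between explicitly scaled spaces\<close>

lemma linI:
  assumes "vector_space sA" "vector_space sB"
    and "\<And>x y. f (x + y) = f x + f y" "\<And>c x. f (sA c x) = sB c (f x)"
  shows "lin sA sB f"
  using assms unfolding Vector_Spaces.linear_def module_hom_def module_hom_axioms_def
    vector_space_def module_def by blast

lemma lin_vs: "lin sA sB f \<Longrightarrow> vector_space sA" "lin sA sB f \<Longrightarrow> vector_space sB"
  unfolding Vector_Spaces.linear_def by auto

lemma lin_add: "lin sA sB f \<Longrightarrow> f (x + y) = f x + f y"
  using Vector_Spaces.linear.axioms module_hom.add by blast

lemma lin_scale: "lin sA sB f \<Longrightarrow> f (sA c x) = sB c (f x)"
  using Vector_Spaces.linear.axioms module_hom.scale by blast

lemma lin_sum_list: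
  assumes "lin sA sB f" shows "f (\<Sum>x\<leftarrow>l. g x) = (\<Sum>x\<leftarrow>l. f (g x))"
proof -
  have "f 0 = 0" using lin_add[OF assms, of 0 0] by simp
  then show ?thesis by (induction l) (simp_all add: lin_add[OF assms])
qed

lemma lin_comp: "lin sB sC f \<Longrightarrow> lin sA sB g \<Longrightarrow> lin sA sC (\<lambda>x. f (g x))"
  by (rule linI) (simp_all add: lin_add[of sA sB g] lin_add[of sB sC f]
    lin_scale[of sA sB g] lin_scale[of sB sC f] lin_vs)

lemma lin_id: "vector_space s \<Longrightarrow> lin s s (\<lambda>x. x)"
  by (rule linI) auto

lemma lin_list_sum:
  assumes "vector_space sA" "vector_space sB" "\<And>i. lin sA sB (\<lambda>x. f x i)"
  shows "lin sA sB (\<lambda>x. \<Sum>i\<leftarrow>l. f x i)"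
proof -
  interpret B: vector_space sB by fact
  show ?thesis
  proof (rule linI[OF assms(1,2)])
    show "(\<Sum>i\<leftarrow>l. f (x + y) i) = (\<Sum>i\<leftarrow>l. f x i) + (\<Sum>i\<leftarrow>l. f y i)" for x y
      by (simp add: lin_add[OF assms(3)] sum_list_addf)
    show "(\<Sum>i\<leftarrow>l. f (sA c x) i) = sB c (\<Sum>i\<leftarrow>l. f x i)" for c x
      by (simp add: lin_scale[OF assms(3)])
        (induction l, simp_all add: B.scale_right_distrib)
  qed
qed

lemma bilinear_mapI:
  "(\<And>y. lin sA sD (\<lambda>x. \<beta> x y)) \<Longrightarrow> (\<And>x. lin sB sD (\<beta> x)) \<Longrightarrow> bilinear_map sA sB sD \<beta>"
  by (simp add: bilinear_map_def)

text \<open>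
  A chosen decomposition of a tensor into pure tensors lets the sums of Sweedler notation be
  formed for arbitrary, not only bilinear, summands: exchanging two sums, or moving a linear map
  under one, then needs no linearity of the summand.
\<close>

definition tensor_rep :: "('k, 'a, 'b, 'c::ab_group_add) tensor \<Rightarrow> 'c \<Rightarrow> ('a \<times> 'b) list" where
  "tensor_rep X z = (SOME l. z = (\<Sum>(x, y)\<leftarrow>l. tens X x y))"

definition tsum ::
  "('k, 'a, 'b, 'c::ab_group_add) tensor \<Rightarrow> 'c \<Rightarrow> ('a \<Rightarrow> 'b \<Rightarrow> 'd::ab_group_add) \<Rightarrow> 'd" where
  "tsum X z \<beta> = (\<Sum>(x, y)\<leftarrow>tensor_rep X z. \<beta> x y)"

lemma lin_tsum_hom:
  "lin s s' f \<Longrightarrow> f (tsum X z \<beta>) = tsum X z (\<lambda>x y. f (\<beta> x y))"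
  by (simp add: tsum_def lin_sum_list case_prod_unfold)

lemma sum_list_swap:
  fixes h :: "'a \<Rightarrow> 'b \<Rightarrow> 'c::comm_monoid_add"
  shows "(\<Sum>x\<leftarrow>l. \<Sum>y\<leftarrow>l'. h x y) = (\<Sum>y\<leftarrow>l'. \<Sum>x\<leftarrow>l. h x y)"
  by (induction l) (simp_all add: sum_list_addf)

lemma tsum_swap:
  "tsum X z (\<lambda>x y. tsum Y w (\<lambda>u v. g x y u v)) = tsum Y w (\<lambda>u v. tsum X z (\<lambda>x y. g x y u v))"
  unfolding tsum_def case_prod_unfold by (rule sum_list_swap)

text \<open>The tensor is fixed and only the summand varies, so linearity of each summand suffices;
  nothing is asked in the summation variables \<open>p\<close> and \<open>q\<close>.\<close>

lemma lin_tsum_param: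
  assumes "\<And>p q. lin s sD (\<lambda>x. \<beta> x p q)"
  shows "lin s sD (\<lambda>x. tsum X z (\<lambda>p q. \<beta> x p q))"
  unfolding tsum_def using assms lin_vs[OF assms]
  by (auto intro!: lin_list_sum simp: case_prod_unfold)

lemma tsum_mult:
  fixes c :: "'a::ring"
  shows "tsum X z \<beta> * c = tsum X z (\<lambda>x y. \<beta> x y * c)"
    and "c * tsum X z \<beta> = tsum X z (\<lambda>x y. c * \<beta> x y)"
  by (simp_all add: tsum_def sum_list_mult_const sum_list_const_mult case_prod_unfold)

section \<open>Sums over tensors and the universal property\<close>

context tensor_product
begin

lemma lin_tens: "lin sA (tscale X) (\<lambda>x. tens X x y)" "lin sB (tscale X) (\<lambda>y. tens X x y)"
  using bilinear_map_tens by (auto simp: bilinear_map_def)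

text \<open>Surjectivity writes \<open>z\<close> as a finite linear combination of pure tensors, and
  the scalars are absorbed into the left factors. Hence a list as in \<open>tensor_rep\<close>
  exists and the choice made there is legitimate.\<close>

lemma tsum_tens_self: "tsum X z (\<lambda>x y. tens X x y) = z"
proof -
  obtain p where z: "z = free_eval (tscale X) (\<lambda>(x, y). tens X x y) p"
    using surjD[OF surj, of z] by blast
  obtain l where l: "set l = Poly_Mapping.keys p" "distinct l"
    using finite_distinct_list[OF finite_keys[of p]] by blast
  have "z = (\<Sum>(x, y)\<leftarrow>l. tscale X (Poly_Mapping.lookup p (x, y)) (tens X x y))"
    unfolding z free_eval_def l(1)[symmetric] sum_list_distinct_conv_sum_set[OF l(2)]
    by (simp add: case_prod_unfold)
  also have "\<dots> = (\<Sum>(x, y)\<leftarrow>map (\<lambda>(x, y). (sA (Poly_Mapping.lookup p (x, y)) x, y)) l. tens X x y)"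
    by (simp add: lin_scale[OF lin_tens(1)] case_prod_unfold comp_def)
  finally have "\<exists>l. z = (\<Sum>(x, y)\<leftarrow>l. tens X x y)" by blast
  from someI_ex[OF this] show ?thesis unfolding tsum_def tensor_rep_def by (rule sym)
qed

text \<open>The lift is linear, so it can be evaluated on the chosen decomposition, where it gives
  \<open>\<beta>\<close> termwise. This translates the \<open>tensor_lift\<close> expressions of the
  axioms into sums.\<close>

lemma lift_eq_tsum:
  assumes "\<And>y. lin sA sD (\<lambda>x. \<beta> x y)" "\<And>x. lin sB sD (\<lambda>y. \<beta> x y)"
  shows "tensor_lift X sD (\<lambda>x y. \<beta> x y) z = tsum X z (\<lambda>x y. \<beta> x y)"
proof -
  note b = lin_vs(2)[OF assms(1)] bilinear_mapI[where \<beta>=\<beta>, OF assms]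
  have "tensor_lift X sD \<beta> (tsum X z (\<lambda>x y. tens X x y)) = tsum X z \<beta>"
    by (simp add: lin_tsum_hom[OF linear_tensor_lift[OF b]] tensor_lift_tens[OF b])
  then show ?thesis by (simp add: tsum_tens_self)
qed

text \<open>The list chosen for \<open>tens X x y\<close> need not consist of the pair
  \<open>(x, y)\<close>; it is bilinearity of \<open>\<beta>\<close> that makes the sum
  collapse.\<close>

lemma tsum_tens:
  assumes "\<And>y. lin sA sD (\<lambda>x. \<beta> x y)" "\<And>x. lin sB sD (\<lambda>y. \<beta> x y)"
  shows "tsum X (tens X x y) (\<lambda>x y. \<beta> x y) = \<beta> x y"
  using lift_eq_tsum[of sD \<beta>, OF assms]
    tensor_lift_tens[OF lin_vs(2)[OF assms(1)] bilinear_mapI[where \<beta>=\<beta>, OF assms]] by simp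

text \<open>In contrast to \<open>lin_tsum_param\<close> the tensor itself varies, and the chosen
  list need not depend linearly on it. The claim therefore goes through the lift.\<close>

lemma lin_tsum:
  assumes "lin s (tscale X) g"
    and "\<And>y. lin sA sD (\<lambda>x. \<beta> x y)" "\<And>x. lin sB sD (\<lambda>y. \<beta> x y)"
  shows "lin s sD (\<lambda>v. tsum X (g v) (\<lambda>x y. \<beta> x y))"
proof -
  note b = lin_vs(2)[OF assms(2)] bilinear_mapI[where \<beta>=\<beta>, OF assms(2,3)]
  have "(\<lambda>v. tsum X (g v) \<beta>) = (\<lambda>v. tensor_lift X sD \<beta> (g v))"
    using lift_eq_tsum[of sD \<beta>, OF assms(2,3)] by simp
  with lin_comp[OF linear_tensor_lift[OF b] assms(1)] show ?thesis by simp
qed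

lemma tsum_tsum:
  assumes "\<And>y. lin sA sD (\<lambda>x. \<beta> x y)" "\<And>x. lin sB sD (\<lambda>y. \<beta> x y)"
  shows "tsum X (tsum Y w (\<lambda>u v. g u v)) (\<lambda>x y. \<beta> x y)
    = tsum Y w (\<lambda>u v. tsum X (g u v) (\<lambda>x y. \<beta> x y))"
  using lin_tsum_hom[OF lin_tsum[OF lin_id[OF target.vector_space_axioms] assms]] .

lemma lin_eq_on_tens:
  assumes "lin (tscale X) sD f" "lin (tscale X) sD g" "\<And>x y. f (tens X x y) = g (tens X x y)"
  shows "f z = g z"
  using linear_eqI[OF assms] by simp

end

context k_algebra
begin

lemma lin_mult_right:
  assumes "lin s' s f" shows "lin s' s (\<lambda>x. f x * c)"
  by (rule linI)
    (auto simp: lin_vs[OF assms] lin_add[OF assms] lin_scale[OF assms] distrib_right scale_mult_left)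

lemma lin_mult_left:
  assumes "lin s' s f" shows "lin s' s (\<lambda>x. c * f x)"
  by (rule linI)
    (auto simp: lin_vs[OF assms] lin_add[OF assms] lin_scale[OF assms] distrib_left scale_mult_right)

end

lemma lin_scale_fun:
  assumes "lin s (*) f" "vector_space sD"
  shows "lin s sD (\<lambda>x. sD (f x) c)"
proof -
  interpret D: vector_space sD by fact
  show ?thesis
    by (rule linI) (auto simp: lin_vs[OF assms(1)] assms(2) lin_add[OF assms(1)] lin_scale[OF assms(1)]
      D.scale_left_distrib)
qed

lemma lin_scale_vec:
  fixes sD :: "'k::field \<Rightarrow> 'd::ab_group_add \<Rightarrow> 'd"
  assumes "lin s sD f"
  shows "lin s sD (\<lambda>x. sD c (f x))"
proof -
  interpret D: vector_space sD using assms by (rule lin_vs)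
  show ?thesis
    by (rule linI) (auto simp: lin_vs[OF assms] lin_add[OF assms] lin_scale[OF assms]
      D.scale_right_distrib D.scale_left_commute mult.commute)
qed

section \<open>Sweedler calculus in a Hopf algebra\<close>

context hopf_algebra
begin

abbreviation "\<Delta> \<equiv> comult T"
abbreviation "\<epsilon> \<equiv> counit T"
abbreviation "S \<equiv> antipode T"
abbreviation "SD t \<beta> \<equiv> tsum (tensor2 T) (\<Delta> t) \<beta>"

lemmas T_id = lin_id[OF vector_space_axioms]
lemmas TT_id = lin_id[OF T2.target.vector_space_axioms]

text \<open>Closure rules for linearity in one Sweedler variable. Applied repeatedly, they discharge
  the multilinearity conditions of the rules below.\<close>

lemmas hopf_lins = T_id TT_id lin_mult_right lin_mult_left lin_comp[OF comult_linear]
  lin_comp[OF counit_linear] lin_comp[OF antipode_linear]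
  lin_tsum_param T2.lin_tsum T3.lin_tsum
  lin_comp[OF T2.lin_tens(1)] lin_comp[OF T2.lin_tens(2)]
  lin_comp[OF T3.lin_tens(1)] lin_comp[OF T3.lin_tens(2)]
  T2.lin_tens T3.lin_tens

text \<open>A trilinear \<open>f\<close> induces a linear map on
  \<open>(T \<otimes> T) \<otimes> T\<close>, called \<open>F\<close> in the proof. Applying it to
  the axiom \<open>coassoc\<close> gives the rule.\<close>

lemma SD_coassoc:
  assumes "\<And>q r. lin (hscale T) sD (\<lambda>p. f p q r)" "\<And>p r. lin (hscale T) sD (\<lambda>q. f p q r)"
    "\<And>p q. lin (hscale T) sD (\<lambda>r. f p q r)"
  shows "SD t (\<lambda>v r. SD v (\<lambda>p q. f p q r)) = SD t (\<lambda>p v. SD v (\<lambda>q r. f p q r))"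
proof -
  define F where "F z = tsum (tensor3 T) z (\<lambda>y r. tsum (tensor2 T) y (\<lambda>p q. f p q r))" for z
  have linF: "lin (tscale (tensor3 T)) sD F"
    unfolding F_def
    by (intro hopf_lins assms lin_id T3.target.vector_space_axioms)
  have F_tens: "F (tens (tensor3 T) y r) = tsum (tensor2 T) y (\<lambda>p q. f p q r)" for y r
    unfolding F_def by (rule T3.tsum_tens[where sD=sD]) (intro hopf_lins assms)+
  have 1: "tensor_map (tensor2 T) (tensor3 T) \<Delta> id (\<Delta> t) = SD t (\<lambda>p r. tens (tensor3 T) (\<Delta> p) r)"
    unfolding tensor_map_def id_apply by (rule T2.lift_eq_tsum; (intro hopf_lins))
  have 2: "tensor_lift (tensor2 T) (tscale (tensor3 T)) (\<lambda>u v. tens (tensor3 T) (tens (tensor2 T) t1 u) v) z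
     = tsum (tensor2 T) z (\<lambda>u v. tens (tensor3 T) (tens (tensor2 T) t1 u) v)" for t1 z
    by (rule T2.lift_eq_tsum; (intro hopf_lins))
  have 3: "tensor_lift (tensor2 T) (tscale (tensor3 T))
         (\<lambda>t1 t2. SD t2 (\<lambda>u v. tens (tensor3 T) (tens (tensor2 T) t1 u) v))
         (\<Delta> t) = SD t (\<lambda>t1 t2. SD t2 (\<lambda>u v. tens (tensor3 T) (tens (tensor2 T) t1 u) v))"
    by (rule T2.lift_eq_tsum; (intro hopf_lins))
  have 4: "tsum (tensor2 T) (tens (tensor2 T) p q) (\<lambda>p q. f p q r) = f p q r" for p q r
    by (rule T2.tsum_tens[where sD=sD and \<beta>="\<lambda>p q. f p q r"]; intro assms)
  have "F (SD t (\<lambda>p r. tens (tensor3 T) (\<Delta> p) r))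
      = F (SD t (\<lambda>t1 t2. SD t2 (\<lambda>u v. tens (tensor3 T) (tens (tensor2 T) t1 u) v)))"
    using coassoc[of t] unfolding 1 2 3 by simp
  then show ?thesis
    by (simp add: lin_tsum_hom[OF linF] F_tens 4)
qed

lemma SD_counit_left:
  assumes "lin (hscale T) sD f" shows "SD t (\<lambda>p q. sD (\<epsilon> p) (f q)) = f t"
proof -
  have "tensor_lift (tensor2 T) (hscale T) (\<lambda>t1 t2. hscale T (\<epsilon> t1) t2) (\<Delta> t) 
    = SD t (\<lambda>t1 t2. hscale T (\<epsilon> t1) t2)"
    by (rule T2.lift_eq_tsum; (intro hopf_lins lin_scale_fun lin_scale_vec vector_space_axioms counit_linear))
  then have "f t = f (SD t (\<lambda>t1 t2. hscale T (\<epsilon> t1) t2))" using counit_left by simp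
  then show ?thesis by (simp add: lin_tsum_hom[OF assms] lin_scale[OF assms])
qed

lemma SD_counit_right:
  assumes "lin (hscale T) sD f" shows "SD t (\<lambda>p q. sD (\<epsilon> q) (f p)) = f t"
proof -
  have "tensor_lift (tensor2 T) (hscale T) (\<lambda>t1 t2. hscale T (\<epsilon> t2) t1) (\<Delta> t) 
    = SD t (\<lambda>t1 t2. hscale T (\<epsilon> t2) t1)"
    by (rule T2.lift_eq_tsum; (intro hopf_lins lin_scale_fun lin_scale_vec vector_space_axioms counit_linear))
  then have "f t = f (SD t (\<lambda>t1 t2. hscale T (\<epsilon> t2) t1))" using counit_right by simp
  then show ?thesis by (simp add: lin_tsum_hom[OF assms] lin_scale[OF assms])
qed

lemma SD_antipode_left:
  assumes "lin (hscale T) sD f" shows "SD t (\<lambda>p q. f (S p * q)) = sD (\<epsilon> t) (f 1)"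
proof -
  have "tensor_lift (tensor2 T) (hscale T) (\<lambda>t1 t2. S t1 * t2) (\<Delta> t) = SD t (\<lambda>t1 t2. S t1 * t2)"
    by (rule T2.lift_eq_tsum; (intro hopf_lins))
  then have "f (SD t (\<lambda>t1 t2. S t1 * t2)) = f (hscale T (\<epsilon> t) 1)" using antipode_left by simp
  then show ?thesis by (simp add: lin_tsum_hom[OF assms] lin_scale[OF assms])
qed

lemma SD_antipode_right:
  assumes "lin (hscale T) sD f" shows "SD t (\<lambda>p q. f (p * S q)) = sD (\<epsilon> t) (f 1)"
proof -
  have "tensor_lift (tensor2 T) (hscale T) (\<lambda>t1 t2. t1 * S t2) (\<Delta> t) = SD t (\<lambda>t1 t2. t1 * S t2)"
    by (rule T2.lift_eq_tsum; (intro hopf_lins))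
  then have "f (SD t (\<lambda>t1 t2. t1 * S t2)) = f (hscale T (\<epsilon> t) 1)" using antipode_right by simp
  then show ?thesis by (simp add: lin_tsum_hom[OF assms] lin_scale[OF assms])
qed

lemma SD_one:
  assumes "\<And>q. lin (hscale T) sD (\<lambda>p. f p q)" "\<And>p. lin (hscale T) sD (\<lambda>q. f p q)"
  shows "SD 1 (\<lambda>p q. f p q) = f 1 1"
  unfolding comult_one by (rule T2.tsum_tens[where sD=sD and \<beta>=f]; intro assms)

lemma antipode_one: "S 1 = 1"
proof -
  have "SD 1 (\<lambda>p q. S p * q) = S 1 * 1"
    by (rule SD_one[where sD="hscale T" and f="\<lambda>p q. S p * q"]; intro hopf_lins)
  then show ?thesis using SD_antipode_left[OF T_id, of 1] by (simp add: counit_one)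
qed

lemma tensor2_mult: "tensor_mult (tensor2 T) (*) (*) z w =
  tsum (tensor2 T) z (\<lambda>x y. tsum (tensor2 T) w (\<lambda>x' y'. tens (tensor2 T) (x * x') (y * y')))"
proof -
  have "tensor_lift (tensor2 T) (tscale (tensor2 T)) (\<lambda>x' y'. tens (tensor2 T) (x * x') (y * y')) w
    = tsum (tensor2 T) w (\<lambda>x' y'. tens (tensor2 T) (x * x') (y * y'))" for x y
    by (rule T2.lift_eq_tsum; (intro hopf_lins))
  then show ?thesis unfolding tensor_mult_def by simp (rule T2.lift_eq_tsum; (intro hopf_lins))
qed

lemma SD_mult:
  assumes "\<And>q. lin (hscale T) sD (\<lambda>p. f p q)" "\<And>p. lin (hscale T) sD (\<lambda>q. f p q)"
  shows "SD (t * u) (\<lambda>p q. f p q) = SD t (\<lambda>p q. SD u (\<lambda>p' q'. f (p * p') (q * q')))"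
proof -
  have "tsum (tensor2 T) (tens (tensor2 T) p q) (\<lambda>p q. f p q) = f p q" for p q
    by (rule T2.tsum_tens[where sD=sD and \<beta>=f]; intro assms)
  then show ?thesis unfolding comult_mult tensor2_mult
    by (simp add: T2.tsum_tsum[of sD f, OF assms])
qed

text \<open>The antipode axiom leaves a counit, which the counit axiom absorbs; coassociativity
  carries the result to the other bracketing. This rule and the next three cover both positions of
  the cancelling pair and both sides of the antipode.\<close>

lemma SD_antipode_mid_left:
  assumes "\<And>q. lin (hscale T) sD (\<lambda>p. g p q)" "\<And>p. lin (hscale T) sD (\<lambda>q. g p q)"
  shows "SD t (\<lambda>p u. SD u (\<lambda>q r. g p (S q * r))) = g t 1"
    and "SD t (\<lambda>u r. SD u (\<lambda>p q. g p (S q * r))) = g t 1"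
proof -
  show 1: "SD t (\<lambda>p u. SD u (\<lambda>q r. g p (S q * r))) = g t 1"
    by (simp add: SD_antipode_left[OF assms(2)] SD_counit_right[OF assms(1)])
  have "SD t (\<lambda>u r. SD u (\<lambda>p q. g p (S q * r))) = SD t (\<lambda>p u. SD u (\<lambda>q r. g p (S q * r)))"
    by (rule SD_coassoc[of sD]; intro hopf_lins lin_comp[OF assms(1)] lin_comp[OF assms(2)])
  with 1 show "SD t (\<lambda>u r. SD u (\<lambda>p q. g p (S q * r))) = g t 1" by simp
qed

lemma SD_antipode_mid_right:
  assumes "\<And>q. lin (hscale T) sD (\<lambda>p. g p q)" "\<And>p. lin (hscale T) sD (\<lambda>q. g p q)"
  shows "SD t (\<lambda>p u. SD u (\<lambda>q r. g p (q * S r))) = g t 1"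
    and "SD t (\<lambda>u r. SD u (\<lambda>p q. g p (q * S r))) = g t 1"
proof -
  show 1: "SD t (\<lambda>p u. SD u (\<lambda>q r. g p (q * S r))) = g t 1"
    by (simp add: SD_antipode_right[OF assms(2)] SD_counit_right[OF assms(1)])
  have "SD t (\<lambda>u r. SD u (\<lambda>p q. g p (q * S r))) = SD t (\<lambda>p u. SD u (\<lambda>q r. g p (q * S r)))"
    by (rule SD_coassoc[of sD]; intro hopf_lins lin_comp[OF assms(1)] lin_comp[OF assms(2)])
  with 1 show "SD t (\<lambda>u r. SD u (\<lambda>p q. g p (q * S r))) = g t 1" by simp
qed

lemma SD_antipode_front_left:
  assumes "\<And>q. lin (hscale T) sD (\<lambda>p. g p q)" "\<And>p. lin (hscale T) sD (\<lambda>q. g p q)"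
  shows "SD t (\<lambda>u r. SD u (\<lambda>p q. g (S p * q) r)) = g 1 t"
    and "SD t (\<lambda>p u. SD u (\<lambda>q r. g (S p * q) r)) = g 1 t"
proof -
  show 1: "SD t (\<lambda>u r. SD u (\<lambda>p q. g (S p * q) r)) = g 1 t"
    by (simp add: SD_antipode_left[OF assms(1)] SD_counit_left[OF assms(2)])
  have "SD t (\<lambda>u r. SD u (\<lambda>p q. g (S p * q) r)) = SD t (\<lambda>p u. SD u (\<lambda>q r. g (S p * q) r))"
    by (rule SD_coassoc[of sD]; intro hopf_lins lin_comp[OF assms(1)] lin_comp[OF assms(2)])
  with 1 show "SD t (\<lambda>p u. SD u (\<lambda>q r. g (S p * q) r)) = g 1 t" by simp
qed

lemma SD_antipode_front_right:
  assumes "\<And>q. lin (hscale T) sD (\<lambda>p. g p q)" "\<And>p. lin (hscale T) sD (\<lambda>q. g p q)"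
  shows "SD t (\<lambda>u r. SD u (\<lambda>p q. g (p * S q) r)) = g 1 t"
    and "SD t (\<lambda>p u. SD u (\<lambda>q r. g (p * S q) r)) = g 1 t"
proof -
  show 1: "SD t (\<lambda>u r. SD u (\<lambda>p q. g (p * S q) r)) = g 1 t"
    by (simp add: SD_antipode_right[OF assms(1)] SD_counit_left[OF assms(2)])
  have "SD t (\<lambda>u r. SD u (\<lambda>p q. g (p * S q) r)) = SD t (\<lambda>p u. SD u (\<lambda>q r. g (p * S q) r))"
    by (rule SD_coassoc[of sD]; intro hopf_lins lin_comp[OF assms(1)] lin_comp[OF assms(2)])
  with 1 show "SD t (\<lambda>p u. SD u (\<lambda>q r. g (p * S q) r)) = g 1 t" by simp
qed

section \<open>The antipode reverses products and coproducts\<close>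

text \<open>Under convolution of maps in two variables, \<open>S (t * u)\<close> is a left inverse
  and \<open>S u * S t\<close> a right inverse of the product \<open>t * u\<close>, so they agree.
  The proof writes this argument out as sums.\<close>

lemma antipode_mult: "S (t * u) = S u * S t"
proof -
  \<comment> \<open>The summand of the triple convolution product, which is bracketed in two ways
    below.\<close>
  let ?f = "\<lambda>t1 u1 t2 u2 t3 u3. S (t1 * u1) * (t2 * u2) * (S u3 * S t3)"
  have right: "SD v (\<lambda>t2 t3. SD w (\<lambda>u2 u3. (t2 * u2) * (S u3 * S t3)))
      = hscale T (\<epsilon> v) (hscale T (\<epsilon> w) 1)" for v w
  proof -
    have "SD w (\<lambda>u2 u3. (t2 * u2) * (S u3 * S t3)) = hscale T (\<epsilon> w) (t2 * S t3)" for t2 t3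
      using SD_antipode_right[of "hscale T" "\<lambda>x. t2 * x * S t3" w]
      by (simp add: mult.assoc hopf_lins)
    moreover have "SD v (\<lambda>t2 t3. hscale T (\<epsilon> w) (t2 * S t3)) = hscale T (\<epsilon> w) (hscale T (\<epsilon> v) 1)"
      using SD_antipode_right[of "hscale T" "\<lambda>x. hscale T (\<epsilon> w) x" v]
      by (simp add: lin_scale_vec T_id scale_left_commute)
    ultimately show ?thesis by (simp add: mult.commute)
  qed
  \<comment> \<open>\<open>SD_mult\<close> merges the two coproducts into that of
    \<open>v * w\<close>, where the antipode axiom applies. The factor \<open>c\<close> later
    becomes \<open>S u3 * S t3\<close>.\<close>
  have left: "SD v (\<lambda>t1 t2. SD w (\<lambda>u1 u2. S (t1 * u1) * (t2 * u2) * c))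
      = hscale T (\<epsilon> v) (hscale T (\<epsilon> w) c)" for v w c
  proof -
    have "SD v (\<lambda>t1 t2. SD w (\<lambda>u1 u2. S (t1 * u1) * (t2 * u2) * c))
        = SD (v * w) (\<lambda>p q. S p * q * c)"
      by (rule SD_mult[symmetric, where sD="hscale T" and f="\<lambda>p q. S p * q * c"]; intro hopf_lins)
    also have "\<dots> = hscale T (\<epsilon> (v * w)) (1 * c)"
      by (rule SD_antipode_left[where f="\<lambda>x. x * c"]) (intro hopf_lins)
    finally show ?thesis by (simp add: counit_mult)
  qed
  \<comment> \<open>Counits are inserted, for which \<open>right\<close> then substitutes the
    remaining two thirds of \<open>?f\<close>.\<close>
  have "S (t * u) = SD t (\<lambda>t1 tr. hscale T (\<epsilon> tr) (SD u (\<lambda>u1 ur. hscale T (\<epsilon> ur) (S (t1 * u1)))))"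
  proof -
    have 1: "SD u (\<lambda>u1 ur. hscale T (\<epsilon> ur) (S (t1 * u1))) = S (t1 * u)" for t1
      by (rule SD_counit_right[of "hscale T" "\<lambda>u1. S (t1 * u1)"]) (intro hopf_lins)
    show ?thesis unfolding 1
      by (rule SD_counit_right[of "hscale T" "\<lambda>t1. S (t1 * u)", symmetric]) (intro hopf_lins)
  qed
  also have "\<dots> = SD t (\<lambda>t1 tr. SD u (\<lambda>u1 ur.
      S (t1 * u1) * SD tr (\<lambda>t2 t3. SD ur (\<lambda>u2 u3. (t2 * u2) * (S u3 * S t3)))))"
    unfolding right
    by (simp add: scale_mult_right lin_tsum_hom[OF lin_scale_vec[OF T_id]])
  also have "\<dots> = SD t (\<lambda>t1 tr. SD u (\<lambda>u1 ur. SD tr (\<lambda>t2 t3. SD ur (\<lambda>u2 u3. ?f t1 u1 t2 u2 t3 u3))))"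
    by (simp add: tsum_mult mult.assoc)
  also have "\<dots> = SD t (\<lambda>t1 tr. SD tr (\<lambda>t2 t3. SD u (\<lambda>u1 ur. SD ur (\<lambda>u2 u3. ?f t1 u1 t2 u2 t3 u3))))"
    by (simp only: tsum_swap[of "tensor2 T" "\<Delta> u"])
  also have "\<dots> = SD t (\<lambda>v t3. SD v (\<lambda>t1 t2. SD u (\<lambda>u1 ur. SD ur (\<lambda>u2 u3. ?f t1 u1 t2 u2 t3 u3))))"
    by (rule SD_coassoc[of "hscale T", symmetric]; intro hopf_lins)
  also have "\<dots> = SD t (\<lambda>v t3. SD v (\<lambda>t1 t2. SD u (\<lambda>w u3. SD w (\<lambda>u1 u2. ?f t1 u1 t2 u2 t3 u3))))"
  proof -
    have "SD u (\<lambda>u1 ur. SD ur (\<lambda>u2 u3. ?f t1 u1 t2 u2 t3 u3))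
      = SD u (\<lambda>w u3. SD w (\<lambda>u1 u2. ?f t1 u1 t2 u2 t3 u3))" for t1 t2 t3
      by (rule SD_coassoc[of "hscale T", symmetric]; intro hopf_lins)
    then show ?thesis by (simp only:)
  qed
  also have "\<dots> = SD t (\<lambda>v t3. SD u (\<lambda>w u3. SD v (\<lambda>t1 t2. SD w (\<lambda>u1 u2. ?f t1 u1 t2 u2 t3 u3))))"
    by (simp only: tsum_swap[of "tensor2 T" "\<Delta> u"])
  also have "\<dots> = SD t (\<lambda>v t3. hscale T (\<epsilon> v) (SD u (\<lambda>w u3. hscale T (\<epsilon> w) (S u3 * S t3))))"
    unfolding left by (simp add: lin_tsum_hom[OF lin_scale_vec[OF T_id]])
  also have "\<dots> = S u * S t"
  proof -
    have 1: "SD u (\<lambda>w u3. hscale T (\<epsilon> w) (S u3 * S t3)) = S u * S t3" for t3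
      by (rule SD_counit_left[of "hscale T" "\<lambda>u3. S u3 * S t3"]) (intro hopf_lins)
    show ?thesis unfolding 1
      by (rule SD_counit_left[of "hscale T" "\<lambda>t3. S u * S t3"]) (intro hopf_lins)
  qed
  finally show ?thesis .
qed

text \<open>A left inverse and a right inverse of \<open>H\<close> coincide, here in the convolution
  algebra of linear maps on \<open>T\<close>. The product \<open>m\<close> is a parameter so that
  the target can be \<open>T \<otimes> T\<close> with its componentwise product.\<close>

lemma convolution_inverse_unique:
  assumes lins: "lin (hscale T) sD F" "lin (hscale T) sD H" "lin (hscale T) sD G"
    and m: "\<And>c. lin sD sD (\<lambda>x. m x c)" "\<And>c. lin sD sD (\<lambda>x. m c x)"
    and assoc: "\<And>x y z. m (m x y) z = m x (m y z)"
    and unit: "\<And>x. m e x = x" "\<And>x. m x e = x"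
    and FH: "\<And>t. SD t (\<lambda>p q. m (F p) (H q)) = sD (\<epsilon> t) e"
    and HG: "\<And>t. SD t (\<lambda>p q. m (H p) (G q)) = sD (\<epsilon> t) e"
  shows "F t = G t"
proof -
  have "F t = SD t (\<lambda>p q. m (F p) (SD q (\<lambda>u v. m (H u) (G v))))"
    unfolding HG by (simp add: lin_scale[OF m(2)] unit SD_counit_right[OF lins(1)])
  also have "\<dots> = SD t (\<lambda>p q. SD q (\<lambda>u v. m (m (F p) (H u)) (G v)))"
    by (simp add: lin_tsum_hom[OF m(2)] assoc)
  also have "\<dots> = SD t (\<lambda>v r. SD v (\<lambda>p q. m (m (F p) (H q)) (G r)))"
    by (rule SD_coassoc[of sD, symmetric]; intro lin_comp[OF m(1)] lin_comp[OF m(2)] lins)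
  also have "\<dots> = SD t (\<lambda>v r. m (SD v (\<lambda>p q. m (F p) (H q))) (G r))"
    by (simp add: lin_tsum_hom[OF m(1)])
  also have "\<dots> = G t"
    unfolding FH by (simp add: lin_scale[OF m(1)] unit SD_counit_left[OF lins(3)])
  finally show ?thesis .
qed

text \<open>Both sides are convolution inverses of \<open>\<Delta>\<close>: the left one because
  \<open>\<Delta>\<close> is multiplicative, the right one by cancelling antipodes twice.\<close>

lemma comult_antipode: "\<Delta> (S t) = SD t (\<lambda>p q. tens (tensor2 T) (S q) (S p))"
proof (rule convolution_inverse_unique[where H=\<Delta> and m="tensor_mult (tensor2 T) (*) (*)"
      and e="tens (tensor2 T) 1 1" and sD="tscale (tensor2 T)"])
  let ?m = "tensor_mult (tensor2 T) (*) (*)" and ?t = "tens (tensor2 T)"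
  have tens_m: "?m (?t x y) w = tsum (tensor2 T) w (\<lambda>x' y'. ?t (x * x') (y * y'))" for x y w
    unfolding tensor2_mult
    by (rule T2.tsum_tens[where sD="tscale (tensor2 T)" and \<beta>="\<lambda>x y. tsum (tensor2 T) w (\<lambda>x' y'. ?t (x * x') (y * y'))"];
        intro hopf_lins)
  have tens_tens: "?m (?t x y) (?t x' y') = ?t (x * x') (y * y')" for x y x' y'
    unfolding tens_m
    by (rule T2.tsum_tens[where sD="tscale (tensor2 T)" and \<beta>="\<lambda>x' y'. ?t (x * x') (y * y')"]; intro hopf_lins)
  show m1: "lin (tscale (tensor2 T)) (tscale (tensor2 T)) (\<lambda>x. ?m x c)" for c
    unfolding tensor2_mult by (intro hopf_lins)
  show m2: "lin (tscale (tensor2 T)) (tscale (tensor2 T)) (\<lambda>x. ?m c x)" for c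
    unfolding tensor2_mult by (intro hopf_lins)
  show "?m (?m x y) z = ?m x (?m y z)" for x y z
  \<comment> \<open>Associativity is inherited from \<open>T\<close> once all three arguments are
    expanded into pure tensors.\<close>
  proof -
    have "?m (?m x y) z = ?m (?m (tsum (tensor2 T) x ?t) (tsum (tensor2 T) y ?t)) (tsum (tensor2 T) z ?t)"
      by (simp add: T2.tsum_tens_self)
    also have "\<dots> = ?m (tsum (tensor2 T) x ?t) (?m (tsum (tensor2 T) y ?t) (tsum (tensor2 T) z ?t))"
      by (simp add: lin_tsum_hom[OF m1] lin_tsum_hom[OF m2] tens_tens mult.assoc)
    finally show ?thesis by (simp add: T2.tsum_tens_self)
  qed
  show "?m (?t 1 1) x = x" for x
    by (simp add: tens_m T2.tsum_tens_self)
  show "?m x (?t 1 1) = x" for x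
    using lin_tsum_hom[OF m1[of "?t 1 1"], where X="tensor2 T" and z=x and \<beta>="?t"] by (simp add: tens_tens T2.tsum_tens_self)
  show "lin (hscale T) (tscale (tensor2 T)) (\<lambda>t. \<Delta> (S t))" by (intro hopf_lins)
  show "lin (hscale T) (tscale (tensor2 T)) \<Delta>" by (rule comult_linear)
  show "lin (hscale T) (tscale (tensor2 T)) (\<lambda>t. SD t (\<lambda>p q. ?t (S q) (S p)))" by (intro hopf_lins)
  show "SD t (\<lambda>p q. ?m (\<Delta> (S p)) (\<Delta> q)) = tscale (tensor2 T) (\<epsilon> t) (?t 1 1)" for t
    using SD_antipode_left[OF comult_linear, of t] by (simp add: comult_mult comult_one)
  show "SD t (\<lambda>u v. ?m (\<Delta> u) (SD v (\<lambda>p q. ?t (S q) (S p)))) = tscale (tensor2 T) (\<epsilon> t) (?t 1 1)" for t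
  proof -
    have mult_comult: "?m (\<Delta> u) w = SD u (\<lambda>a b. ?m (?t a b) w)" for u w
      using lin_tsum_hom[OF m1[of w], where X="tensor2 T" and z="\<Delta> u" and \<beta>="?t"] by (simp add: T2.tsum_tens_self)
    \<comment> \<open>In Sweedler notation this is \<open>t1 S t4 \<otimes> t2 S t3\<close>. The
      inner pair \<open>t2 S t3\<close> cancels first, then the outer one.\<close>
    have "SD t (\<lambda>u v. ?m (\<Delta> u) (SD v (\<lambda>p q. ?t (S q) (S p))))
      = SD t (\<lambda>u v. SD u (\<lambda>a b. SD v (\<lambda>p q. ?t (a * S q) (b * S p))))"
      unfolding mult_comult by (simp add: lin_tsum_hom[OF m2] tens_tens)
    also have "\<dots> = SD t (\<lambda>a w. SD w (\<lambda>b v. SD v (\<lambda>p q. ?t (a * S q) (b * S p))))"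
      by (rule SD_coassoc[of "tscale (tensor2 T)"]; intro hopf_lins)
    also have "\<dots> = SD t (\<lambda>a w. ?t (a * S w) 1)"
    proof -
      have "SD w (\<lambda>b v. SD v (\<lambda>p q. ?t (a * S q) (b * S p))) = ?t (a * S w) 1" for a w
        by (rule SD_antipode_front_right(2)[where sD="tscale (tensor2 T)" and g="\<lambda>x q. ?t (a * S q) x"]; intro hopf_lins)
      then show ?thesis by simp
    qed
    also have "\<dots> = tscale (tensor2 T) (\<epsilon> t) (?t 1 1)"
      by (rule SD_antipode_right[where f="\<lambda>x. ?t x 1"]) (intro hopf_lins)
    finally show ?thesis .
  qed
qed

lemma SD_antipode_arg:
  assumes "\<And>q. lin (hscale T) sD (\<lambda>p. f p q)" "\<And>p. lin (hscale T) sD (\<lambda>q. f p q)"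
  shows "SD (S t) (\<lambda>p q. f p q) = SD t (\<lambda>p q. f (S q) (S p))"
proof -
  have "tsum (tensor2 T) (tens (tensor2 T) p q) (\<lambda>p q. f p q) = f p q" for p q
    by (rule T2.tsum_tens[where sD=sD and \<beta>=f]; intro assms)
  then show ?thesis unfolding comult_antipode by (simp add: T2.tsum_tsum[of sD f, OF assms])
qed

end

section \<open>The smash product and the map \<open>\<tau>\<close>\<close>

context braided_commutative_yd_module_algebra
begin

abbreviation "SC a \<beta> \<equiv> tsum (AT A) (coact A a) \<beta>"
abbreviation "sH \<equiv> tscale (AT A)"
abbreviation smash (infixl "\<star>" 70) where "g \<star> h \<equiv> smash_mult T A g h"
abbreviation "\<alpha> \<equiv> incl_A A"
abbreviation "\<iota> \<equiv> incl_T A"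

lemma lin_act:
  "lin (hscale T) (ascale A) (\<lambda>t. act A t a)" "lin (ascale A) (ascale A) (\<lambda>a. act A t a)"
  using act_bilinear by (auto simp: bilinear_map_def)

lemmas A_id = lin_id[OF A.vector_space_axioms]
lemmas AT_id = lin_id[OF AT.target.vector_space_axioms]

lemmas yd_lins = hopf_lins A_id AT_id A.lin_mult_right A.lin_mult_left
  lin_comp[OF lin_act(1)] lin_comp[OF lin_act(2)] lin_comp[OF coact_linear]
  AT.lin_tsum ATT.lin_tsum
  lin_comp[OF AT.lin_tens(1)] lin_comp[OF AT.lin_tens(2)]
  lin_comp[OF ATT.lin_tens(1)] lin_comp[OF ATT.lin_tens(2)]
  lin_act AT.lin_tens ATT.lin_tens

section \<open>Sums over the coaction, and the Yetter-Drinfeld condition\<close>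

lemma SC_coassoc:
  assumes "\<And>p q. lin (ascale A) sD (\<lambda>x. f x p q)" "\<And>x q. lin (hscale T) sD (\<lambda>p. f x p q)"
    "\<And>x p. lin (hscale T) sD (\<lambda>q. f x p q)"
  shows "SC a (\<lambda>b q. SC b (\<lambda>x p. f x p q)) = SC a (\<lambda>x u. SD u (\<lambda>p q. f x p q))"
proof -
  define F where "F z = tsum (ATT A) z (\<lambda>y r. tsum (AT A) y (\<lambda>p q. f p q r))" for z
  have linF: "lin (tscale (ATT A)) sD F"
    unfolding F_def
    by (intro yd_lins assms lin_id ATT.target.vector_space_axioms)
  have F_tens: "F (tens (ATT A) y r) = tsum (AT A) y (\<lambda>p q. f p q r)" for y r
    unfolding F_def by (rule ATT.tsum_tens[where sD=sD]) (intro yd_lins assms)+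
  have 1: "tensor_map (AT A) (ATT A) (coact A) id (coact A a) = SC a (\<lambda>p r. tens (ATT A) (coact A p) r)"
    unfolding tensor_map_def id_apply by (rule AT.lift_eq_tsum; (intro yd_lins))
  have 2: "tensor_lift (tensor2 T) (tscale (ATT A)) (\<lambda>u v. tens (ATT A) (tens (AT A) t1 u) v) z
     = tsum (tensor2 T) z (\<lambda>u v. tens (ATT A) (tens (AT A) t1 u) v)" for t1 z
    by (rule T2.lift_eq_tsum; (intro yd_lins))
  have 3: "tensor_lift (AT A) (tscale (ATT A))
         (\<lambda>t1 t2. SD t2 (\<lambda>u v. tens (ATT A) (tens (AT A) t1 u) v))
         (coact A a) = SC a (\<lambda>t1 t2. SD t2 (\<lambda>u v. tens (ATT A) (tens (AT A) t1 u) v))"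
    by (rule AT.lift_eq_tsum; (intro yd_lins))
  have 4: "tsum (AT A) (tens (AT A) p q) (\<lambda>p q. f p q r) = f p q r" for p q r
    by (rule AT.tsum_tens[where sD=sD and \<beta>="\<lambda>p q. f p q r"]; intro assms)
  have "F (SC a (\<lambda>p r. tens (ATT A) (coact A p) r))
      = F (SC a (\<lambda>t1 t2. SD t2 (\<lambda>u v. tens (ATT A) (tens (AT A) t1 u) v)))"
    using coact_coassoc[of a] unfolding 1 2 3 by simp
  then show ?thesis
    by (simp add: lin_tsum_hom[OF linF] F_tens 4)
qed

lemma AT_op_mult: "tensor_mult (AT A) (*) (\<lambda>t u. u * t) z w =
  tsum (AT A) z (\<lambda>x y. tsum (AT A) w (\<lambda>x' y'. tens (AT A) (x * x') (y' * y)))"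
proof -
  have "tensor_lift (AT A) sH (\<lambda>x' y'. tens (AT A) (x * x') (y' * y)) w
    = tsum (AT A) w (\<lambda>x' y'. tens (AT A) (x * x') (y' * y))" for x y
    by (rule AT.lift_eq_tsum; (intro yd_lins))
  then show ?thesis unfolding tensor_mult_def by simp (rule AT.lift_eq_tsum; (intro yd_lins))
qed

lemma SC_mult:
  assumes "\<And>q. lin (ascale A) sD (\<lambda>p. f p q)" "\<And>p. lin (hscale T) sD (\<lambda>q. f p q)"
  shows "SC (a * b) (\<lambda>p q. f p q) = SC a (\<lambda>p q. SC b (\<lambda>p' q'. f (p * p') (q' * q)))"
proof -
  have "tsum (AT A) (tens (AT A) p q) (\<lambda>p q. f p q) = f p q" for p q
    by (rule AT.tsum_tens[where sD=sD and \<beta>=f]; intro assms)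
  then show ?thesis unfolding coact_product AT_op_mult
    by (simp add: AT.tsum_tsum[of sD f, OF assms])
qed

lemma SC_one:
  assumes "\<And>q. lin (ascale A) sD (\<lambda>p. f p q)" "\<And>p. lin (hscale T) sD (\<lambda>q. f p q)"
  shows "SC 1 (\<lambda>p q. f p q) = f 1 1"
  unfolding coact_unit by (rule AT.tsum_tens[where sD=sD and \<beta>=f]; intro assms)

lemma act_product_SD: "act A t (a * b) = SD t (\<lambda>p q. act A p a * act A q b)"
  unfolding act_product by (rule T2.lift_eq_tsum; (intro yd_lins))

lemma braided_commutative_SC: "SC x (\<lambda>x0 x1. x0 * act A x1 a) = a * x"
  by (rule AT.lift_eq_tsum[symmetric, THEN trans, OF _ _ braided_commutative]; (intro yd_lins))

lemma yetter_drinfeld_SD: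
  assumes "\<And>q. lin (ascale A) sD (\<lambda>p. f p q)" "\<And>p. lin (hscale T) sD (\<lambda>q. f p q)"
  shows "SD t (\<lambda>p q. SC a (\<lambda>x y. f (act A p x) (q * y)))
    = SD t (\<lambda>p q. SC (act A q a) (\<lambda>x y. f x (y * p)))"
proof -
  have 1: "tensor_lift (AT A) sH (\<lambda>a0 a1. tens (AT A) (act A p a0) (q * a1)) z
    = tsum (AT A) z (\<lambda>a0 a1. tens (AT A) (act A p a0) (q * a1))" for p q z
    by (rule AT.lift_eq_tsum; (intro yd_lins))
  have 2: "tensor_lift (AT A) sH (\<lambda>b0 b1. tens (AT A) b0 (b1 * p)) z
    = tsum (AT A) z (\<lambda>b0 b1. tens (AT A) b0 (b1 * p))" for p z
    by (rule AT.lift_eq_tsum; (intro yd_lins))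
  have 3: "tensor_lift (tensor2 T) sH (\<lambda>p q. SC a (\<lambda>a0 a1. tens (AT A) (act A p a0) (q * a1))) (\<Delta> t)
    = SD t (\<lambda>p q. SC a (\<lambda>a0 a1. tens (AT A) (act A p a0) (q * a1)))"
    by (rule T2.lift_eq_tsum; (intro yd_lins))
  have 4: "tensor_lift (tensor2 T) sH (\<lambda>p q. SC (act A q a) (\<lambda>b0 b1. tens (AT A) b0 (b1 * p))) (\<Delta> t)
    = SD t (\<lambda>p q. SC (act A q a) (\<lambda>b0 b1. tens (AT A) b0 (b1 * p)))"
    by (rule T2.lift_eq_tsum; (intro yd_lins))
  define F where "F z = tsum (AT A) z f" for z
  have linF: "lin sH sD F" unfolding F_def by (rule AT.lin_tsum[OF AT_id, of sD f, OF assms])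
  have F_tens: "F (tens (AT A) p q) = f p q" for p q
    unfolding F_def by (rule AT.tsum_tens[where sD=sD and \<beta>=f]; intro assms)
  have "F (SD t (\<lambda>p q. SC a (\<lambda>a0 a1. tens (AT A) (act A p a0) (q * a1))))
     = F (SD t (\<lambda>p q. SC (act A q a) (\<lambda>b0 b1. tens (AT A) b0 (b1 * p))))"
    using yetter_drinfeld[of a t] unfolding 1 2 3 4 by simp
  then show ?thesis by (simp add: lin_tsum_hom[OF linF] F_tens)
qed

text \<open>In Sweedler notation the right-hand side is
  \<open>(S w2 \<triangleright> a0) \<otimes> S w1 a1 w3\<close>. The Yetter-Drinfeld condition at
  \<open>S v\<close> turns it into the coaction of \<open>S w1 \<triangleright> a\<close> with an
  additional factor \<open>S w2 w3\<close>, which cancels.\<close>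

lemma SC_act_antipode:
  assumes f: "\<And>q. lin (ascale A) sD (\<lambda>p. f p q)" "\<And>p. lin (hscale T) sD (\<lambda>q. f p q)"
  shows "SC (act A (S w) a) (\<lambda>x y. f x y)
    = SD w (\<lambda>v r. SD v (\<lambda>p q. SC a (\<lambda>x y. f (act A (S q) x) (S p * y * r))))"
proof -
  note fl = lin_comp[OF f(1)] lin_comp[OF f(2)]
  have eq: "SD v (\<lambda>p q. SC a (\<lambda>x y. f (act A (S q) x) (S p * y * r)))
    = SD v (\<lambda>p q. SC (act A (S p) a) (\<lambda>x y. f x (y * (S q * r))))" for v r
  proof -
    have "SD v (\<lambda>p q. SC a (\<lambda>x y. f (act A (S q) x) (S p * y * r)))
      = SD (S v) (\<lambda>p q. SC a (\<lambda>x y. f (act A p x) (q * y * r)))"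
      by (rule SD_antipode_arg[of sD, symmetric]; intro yd_lins fl)
    also have "\<dots> = SD (S v) (\<lambda>p q. SC (act A q a) (\<lambda>x y. f x (y * p * r)))"
      by (rule yetter_drinfeld_SD[of sD "\<lambda>x y. f x (y * r)"]; intro yd_lins fl)
    also have "\<dots> = SD v (\<lambda>p q. SC (act A (S p) a) (\<lambda>x y. f x (y * S q * r)))"
      by (rule SD_antipode_arg[of sD]; intro yd_lins fl)
    finally show ?thesis by (simp add: mult.assoc)
  qed
  have "SD w (\<lambda>v r. SD v (\<lambda>p q. SC (act A (S p) a) (\<lambda>x y. f x (y * (S q * r)))))
    = SC (act A (S w) a) (\<lambda>x y. f x (y * 1))"
    by (rule SD_antipode_mid_left(2)[of sD "\<lambda>p q. SC (act A (S p) a) (\<lambda>x y. f x (y * q))"];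
      intro yd_lins fl)
  then show ?thesis unfolding eq by simp
qed

section \<open>Associativity of the smash product\<close>

lemma smash_mult_tsum: "g \<star> h = tsum (AT A) g (\<lambda>a t. tsum (AT A) h (\<lambda>a' t'.
   SD t (\<lambda>p q. tens (AT A) (a * act A p a') (q * t'))))"
proof -
  have 1: "tensor_lift (tensor2 T) sH (\<lambda>p q. tens (AT A) (a * act A p a') (q * t')) z
    = tsum (tensor2 T) z (\<lambda>p q. tens (AT A) (a * act A p a') (q * t'))" for a a' t' z
    by (rule T2.lift_eq_tsum; (intro yd_lins))
  have 2: "tensor_lift (AT A) sH (\<lambda>a' t'. SD t (\<lambda>p q. tens (AT A) (a * act A p a') (q * t'))) h
    = tsum (AT A) h (\<lambda>a' t'. SD t (\<lambda>p q. tens (AT A) (a * act A p a') (q * t')))" for a t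
    by (rule AT.lift_eq_tsum; (intro yd_lins))
  show ?thesis unfolding smash_mult_def 1 2
    by (rule AT.lift_eq_tsum; (intro yd_lins))
qed

lemma lin_smash: "lin sH sH (\<lambda>g. g \<star> h)" "lin sH sH (\<lambda>h. g \<star> h)"
  unfolding smash_mult_tsum by (intro yd_lins)+

lemma lin_incl: "lin (ascale A) sH \<alpha>" "lin (hscale T) sH \<iota>"
  unfolding incl_A_def[abs_def] incl_T_def[abs_def] by (intro yd_lins)+

lemmas smash_lins = yd_lins lin_comp[OF lin_smash(1)] lin_comp[OF lin_smash(2)]
  lin_comp[OF lin_incl(1)] lin_comp[OF lin_incl(2)]

lemmas smash_tsum = lin_tsum_hom[OF lin_smash(1)] lin_tsum_hom[OF lin_smash(2)]
lemmas incl_tsum = lin_tsum_hom[OF lin_incl(1)] lin_tsum_hom[OF lin_incl(2)]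

lemma smash_tens:
  "tens (AT A) a t \<star> tens (AT A) b u = SD t (\<lambda>p q. tens (AT A) (a * act A p b) (q * u))"
proof -
  have 1: "tsum (AT A) (tens (AT A) b u) (\<lambda>a' t'. SD t (\<lambda>p q. tens (AT A) (a * act A p a') (q * t')))
    = SD t (\<lambda>p q. tens (AT A) (a * act A p b) (q * u))" for a t
    by (rule AT.tsum_tens[where sD=sH and
          \<beta>="\<lambda>a' t'. SD t (\<lambda>p q. tens (AT A) (a * act A p a') (q * t'))"]; intro yd_lins)
  show ?thesis unfolding smash_mult_tsum 1
    by (rule AT.tsum_tens[where sD=sH and
          \<beta>="\<lambda>a t. SD t (\<lambda>p q. tens (AT A) (a * act A p b) (q * u))"]; intro yd_lins)
qed

text \<open>Multiplicativity of the coproduct expands the left side, the module algebra laws expand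
  the right side, and coassociativity for \<open>t\<close> matches them.\<close>

lemma smash_assoc_tens:
  "tens (AT A) a t \<star> tens (AT A) b u \<star> tens (AT A) c v
    = tens (AT A) a t \<star> (tens (AT A) b u \<star> tens (AT A) c v)"
proof -
  let ?f = "\<lambda>p m n m' n'. tens (AT A) (a * (act A p b * act A (m * m') c)) (n * n' * v)"
  have "tens (AT A) a t \<star> tens (AT A) b u \<star> tens (AT A) c v
    = SD t (\<lambda>p q. SD (q * u) (\<lambda>m n. tens (AT A) (a * act A p b * act A m c) (n * v)))"
    by (simp add: smash_tens smash_tsum)
  also have "\<dots> = SD t (\<lambda>p q. SD q (\<lambda>m n. SD u (\<lambda>m' n'. ?f p m n m' n')))"
  proof -
    have "SD (q * u) (\<lambda>m n. tens (AT A) (a * act A p b * act A m c) (n * v))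
      = SD q (\<lambda>m n. SD u (\<lambda>m' n'. tens (AT A) (a * act A p b * act A (m * m') c) (n * n' * v)))" for p q
      by (rule SD_mult[where sD=sH and f="\<lambda>m n. tens (AT A) (a * act A p b * act A m c) (n * v)"];
        intro yd_lins)
    then show ?thesis by (simp add: mult.assoc)
  qed
  \<comment> \<open>The two factors of \<open>t\<close> that act on \<open>b\<close> and on
    \<open>c\<close> are gathered into one coproduct, as in \<open>act_product_SD\<close>.\<close>
  also have "\<dots> = SD t (\<lambda>w n. SD w (\<lambda>p m. SD u (\<lambda>m' n'. ?f p m n m' n')))"
    by (rule SD_coassoc[of sH, symmetric]; intro yd_lins)
  also have "\<dots> = SD t (\<lambda>w n. SD u (\<lambda>m' n'. SD w (\<lambda>p m. ?f p m n m' n')))"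
    by (simp only: tsum_swap[of "tensor2 T" "\<Delta> u"])
  also have "\<dots> = SD u (\<lambda>m' n'. SD t (\<lambda>w n. SD w (\<lambda>p m. ?f p m n m' n')))"
    by (rule tsum_swap)
  also have "\<dots> = SD u (\<lambda>m' n'. SD t (\<lambda>w n. tens (AT A) (a * act A w (b * act A m' c)) (n * (n' * v))))"
    by (simp add: act_product_SD act_mult tsum_mult lin_tsum_hom[OF AT.lin_tens(1)] mult.assoc)
  also have "\<dots> = tens (AT A) a t \<star> (tens (AT A) b u \<star> tens (AT A) c v)"
    by (simp add: smash_tens smash_tsum)
  finally show ?thesis .
qed

lemma smash_assoc: "g \<star> h \<star> k = g \<star> (h \<star> k)"
proof -
  have 1: "tens (AT A) a t \<star> tens (AT A) b u \<star> k = tens (AT A) a t \<star> (tens (AT A) b u \<star> k)" for a t b u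
    by (rule AT.lin_eq_on_tens[where f="\<lambda>k. tens (AT A) a t \<star> tens (AT A) b u \<star> k" and sD=sH
          and g="\<lambda>k. tens (AT A) a t \<star> (tens (AT A) b u \<star> k)"]; intro smash_lins smash_assoc_tens)
  have 2: "tens (AT A) a t \<star> h \<star> k = tens (AT A) a t \<star> (h \<star> k)" for a t
    by (rule AT.lin_eq_on_tens[where f="\<lambda>h. tens (AT A) a t \<star> h \<star> k" and sD=sH
          and g="\<lambda>h. tens (AT A) a t \<star> (h \<star> k)"]; intro smash_lins 1)
  show ?thesis
    by (rule AT.lin_eq_on_tens[where f="\<lambda>g. g \<star> h \<star> k" and sD=sH
          and g="\<lambda>g. g \<star> (h \<star> k)"]; intro smash_lins 2)
qed

section \<open>\<open>A\<close> and \<open>T\<close> inside the smash product, and the unit\<close>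

lemma incl_A_mult: "\<alpha> a \<star> \<alpha> b = \<alpha> (a * b)"
proof -
  have "SD 1 (\<lambda>p q. tens (AT A) (a * act A p b) (q * 1)) = tens (AT A) (a * act A 1 b) (1 * 1)"
    by (rule SD_one[where sD=sH and f="\<lambda>p q. tens (AT A) (a * act A p b) (q * 1)"]; intro yd_lins)
  then show ?thesis by (simp add: incl_A_def smash_tens act_one)
qed

lemma incl_A_T: "\<alpha> a \<star> \<iota> t = tens (AT A) a t"
proof -
  have "SD 1 (\<lambda>p q. tens (AT A) (a * act A p 1) (q * t)) = tens (AT A) (a * act A 1 1) (1 * t)"
    by (rule SD_one[where sD=sH and f="\<lambda>p q. tens (AT A) (a * act A p 1) (q * t)"]; intro yd_lins)
  then show ?thesis by (simp add: incl_A_def incl_T_def smash_tens act_one)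
qed

lemma incl_T_mult: "\<iota> t \<star> \<iota> u = \<iota> (t * u)"
proof -
  have "SD t (\<lambda>p q. tens (AT A) (ascale A (\<epsilon> p) 1) (q * u)) = tens (AT A) 1 (t * u)"
    unfolding lin_scale[OF AT.lin_tens(1)] by (rule SD_counit_left) (intro yd_lins)
  then show ?thesis by (simp add: incl_T_def smash_tens act_unit)
qed

lemma incl_T_A: "\<iota> t \<star> \<alpha> a = SD t (\<lambda>p q. \<alpha> (act A p a) \<star> \<iota> q)"
  unfolding incl_A_T by (simp add: incl_T_def incl_A_def smash_tens)

lemma incl_one: "\<alpha> 1 = smash_one A" "\<iota> 1 = smash_one A"
  by (simp_all add: incl_A_def incl_T_def smash_one_def)

lemma smash_one_left: "smash_one A \<star> h = h"
proof (rule AT.lin_eq_on_tens[where f="\<lambda>h. smash_one A \<star> h" and g="\<lambda>h. h" and sD=sH])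
  show "smash_one A \<star> tens (AT A) b u = tens (AT A) b u" for b u
    unfolding incl_A_T[symmetric] smash_assoc[symmetric] incl_one[symmetric] incl_A_mult by simp
qed (intro smash_lins)+

lemma smash_one_right: "h \<star> smash_one A = h"
proof (rule AT.lin_eq_on_tens[where f="\<lambda>h. h \<star> smash_one A" and g="\<lambda>h. h" and sD=sH])
  show "tens (AT A) b u \<star> smash_one A = tens (AT A) b u" for b u
    unfolding incl_A_T[symmetric] smash_assoc incl_one(2)[symmetric] incl_T_mult by simp
qed (intro smash_lins)+

lemmas smash_one = smash_one_left smash_one_right

lemma incl_mult_left:
  "\<alpha> a \<star> (\<alpha> b \<star> h) = \<alpha> (a * b) \<star> h" "\<iota> t \<star> (\<iota> u \<star> h) = \<iota> (t * u) \<star> h"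
  by (simp_all add: incl_A_mult incl_T_mult flip: smash_assoc)

lemmas smash_simps = smash_assoc smash_tsum incl_T_mult incl_A_mult incl_mult_left incl_one smash_one

text \<open>Moving \<open>t1\<close> past \<open>a\<close> produces
  \<open>(t1 \<triangleright> a) t2 S t3\<close>, whose last two factors cancel. The action thus
  becomes inner in the smash product.\<close>

lemma incl_A_act: "\<alpha> (act A t a) = SD t (\<lambda>p q. \<iota> p \<star> \<alpha> a \<star> \<iota> (S q))"
proof -
  have "SD t (\<lambda>p q. \<iota> p \<star> \<alpha> a \<star> \<iota> (S q)) = SD t (\<lambda>p q. SD p (\<lambda>m n. \<alpha> (act A m a) \<star> \<iota> (n * S q)))"
    by (simp add: incl_T_A smash_simps)
  also have "\<dots> = \<alpha> (act A t a) \<star> \<iota> 1"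
    by (rule SD_antipode_mid_right(2)[of sH "\<lambda>m x. \<alpha> (act A m a) \<star> \<iota> x"]; intro smash_lins)
  finally show ?thesis by (simp add: smash_simps)
qed

text \<open>Once the action is written as an inner one, \<open>S p\<close> cancels against its first
  factor.\<close>

lemma SD_antipode_act: "SD v (\<lambda>p q. \<iota> (S p) \<star> \<alpha> (act A q x)) = \<alpha> x \<star> \<iota> (S v)"
proof -
  have "SD v (\<lambda>p q. \<iota> (S p) \<star> \<alpha> (act A q x))
    = SD v (\<lambda>p q. SD q (\<lambda>m n. \<iota> (S p * m) \<star> (\<alpha> x \<star> \<iota> (S n))))"
    by (simp add: incl_A_act smash_simps)
  also have "\<dots> = \<iota> 1 \<star> (\<alpha> x \<star> \<iota> (S v))"
    by (rule SD_antipode_front_left(2)[of sH "\<lambda>y n. \<iota> y \<star> (\<alpha> x \<star> \<iota> (S n))"]; intro smash_lins)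
  finally show ?thesis by (simp add: smash_simps)
qed

text \<open>This is the commutation rule \<open>incl_T_A\<close> at \<open>S v\<close>, read
  backwards; the antipode reverses the coproduct.\<close>

lemma SD_act_antipode: "SD v (\<lambda>p q. \<alpha> (act A (S q) x) \<star> \<iota> (S p * z)) = \<iota> (S v) \<star> (\<alpha> x \<star> \<iota> z)"
proof -
  have "SD v (\<lambda>p q. \<alpha> (act A (S q) x) \<star> \<iota> (S p * z)) = SD (S v) (\<lambda>p q. \<alpha> (act A p x) \<star> \<iota> (q * z))"
    by (rule SD_antipode_arg[of sH "\<lambda>p q. \<alpha> (act A p x) \<star> \<iota> (q * z)", symmetric]; intro smash_lins)
  also have "\<dots> = \<iota> (S v) \<star> \<alpha> x \<star> \<iota> z"
    by (simp add: incl_T_A smash_simps)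
  finally show ?thesis by (simp add: smash_assoc)
qed

section \<open>The target map\<close>

text \<open>By \<open>incl_A_T\<close> and \<open>tsum_tens_self\<close> this is the coaction
  itself, read as an element of the smash product. It is written with \<open>\<star>\<close> so that
  the product rules apply.\<close>

definition tgt :: "'a \<Rightarrow> 'at" where
  "tgt a = SC a (\<lambda>x y. \<alpha> x \<star> \<iota> y)"

text \<open>Moving \<open>b\<close> to the left gives \<open>x0 (x1 \<triangleright> b) x2\<close>.
  Coassociativity groups the first two factors, and braided commutativity turns them into
  \<open>b x0\<close>.\<close>

lemma tgt_commute: "tgt x \<star> \<alpha> b = \<alpha> b \<star> tgt x"
proof -
  have "tgt x \<star> \<alpha> b = SC x (\<lambda>y u. SD u (\<lambda>p q. \<alpha> (y * act A p b) \<star> \<iota> q))"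
    by (simp add: tgt_def smash_simps incl_T_A)
  also have "\<dots> = SC x (\<lambda>y q. SC y (\<lambda>z p. \<alpha> (z * act A p b) \<star> \<iota> q))"
    by (rule SC_coassoc[of sH, symmetric]; intro smash_lins)
  also have "\<dots> = SC x (\<lambda>y q. \<alpha> (SC y (\<lambda>z p. z * act A p b)) \<star> \<iota> q)"
    by (simp only: smash_tsum incl_tsum)
  also have "\<dots> = \<alpha> b \<star> tgt x"
    by (simp add: braided_commutative_SC tgt_def smash_simps)
  finally show ?thesis .
qed

text \<open>\<open>SC_act_antipode\<close> yields
  \<open>(S w2 \<triangleright> a0) S w1 a1 w3\<close>, and \<open>SD_act_antipode\<close> replaces
  the action by a factor \<open>S w1\<close> on the left.\<close>

lemma tgt_act_antipode: "tgt (act A (S w) a) = SD w (\<lambda>v r. \<iota> (S v) \<star> tgt a \<star> \<iota> r)"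
proof -
  have "tgt (act A (S w) a)
    = SD w (\<lambda>v r. SD v (\<lambda>p q. SC a (\<lambda>x y. \<alpha> (act A (S q) x) \<star> \<iota> (S p * y * r))))"
    unfolding tgt_def
    by (rule SC_act_antipode[of sH "\<lambda>x y. \<alpha> x \<star> \<iota> y"]; intro smash_lins)
  also have "\<dots> = SD w (\<lambda>v r. SC a (\<lambda>x y. SD v (\<lambda>p q. \<alpha> (act A (S q) x) \<star> \<iota> (S p * (y * r)))))"
    unfolding mult.assoc by (intro arg_cong[where f="tsum _ _"] ext tsum_swap)
  finally show ?thesis unfolding SD_act_antipode by (simp add: tgt_def smash_simps)
qed

section \<open>Antimultiplicativity of \<open>tau\<close>\<close>

lemma tau_tsum:
  "tau T A h = tsum (AT A) h (\<lambda>a t. SC a (\<lambda>x y. \<iota> (S t * S (S y)) \<star> \<alpha> x))"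
proof -
  have 1: "tensor_lift (AT A) sH (\<lambda>x y. \<iota> (S t * S (S y)) \<star> \<alpha> x) z
    = tsum (AT A) z (\<lambda>x y. \<iota> (S t * S (S y)) \<star> \<alpha> x)" for t z
    by (rule AT.lift_eq_tsum; (intro smash_lins))
  show ?thesis unfolding tau_def 1 by (rule AT.lift_eq_tsum; (intro smash_lins))
qed

lemma lin_tau: "lin sH sH (tau T A)"
  unfolding tau_tsum[abs_def] by (intro smash_lins)

lemma tau_tens: "tau T A (tens (AT A) a t) = SC a (\<lambda>x y. \<iota> (S t * S (S y)) \<star> \<alpha> x)"
  unfolding tau_tsum
  by (rule AT.tsum_tens[of sH "\<lambda>a t. SC a (\<lambda>x y. \<iota> (S t * S (S y)) \<star> \<alpha> x)"]; intro smash_lins)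

lemma tau_incl_A: "tau T A (\<alpha> a) = SC a (\<lambda>x y. \<iota> (S (S y)) \<star> \<alpha> x)"
  by (simp add: incl_A_def[of A a] tau_tens antipode_one)

lemma tau_incl_T: "tau T A (\<iota> t) = \<iota> (S t)"
proof -
  have "SC 1 (\<lambda>x y. \<iota> (S t * S (S y)) \<star> \<alpha> x) = \<iota> (S t * S (S 1)) \<star> \<alpha> 1"
    by (rule SC_one[of sH "\<lambda>x y. \<iota> (S t * S (S y)) \<star> \<alpha> x"]; intro smash_lins)
  then show ?thesis by (simp add: incl_T_def[of A t] tau_tens antipode_one smash_simps)
qed

lemma tau_incl_A_T: "tau T A (\<alpha> a \<star> \<iota> t) = \<iota> (S t) \<star> tau T A (\<alpha> a)"
  by (simp add: incl_A_T tau_tens tau_incl_A smash_simps)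

text \<open>By \<open>tgt_act_antipode\<close> at \<open>S u\<close>, the target value is
  \<open>S (S u2) b0 b1 S u1\<close>. When \<open>b\<close> and \<open>u\<close> come from the
  coaction of \<open>x\<close>, coassociativity makes \<open>b1 S u1\<close> cancel. Commutation of
  \<open>tau x\<close> with \<open>A\<close> then follows from \<open>tgt_commute\<close>.\<close>

lemma tau_incl_A_tgt: "tau T A (\<alpha> x) = SC x (\<lambda>y z. tgt (act A (S (S z)) y))"
proof -
  have "tgt (act A (S (S u)) b) = SC b (\<lambda>y z. SD u (\<lambda>p q. \<iota> (S (S q)) \<star> (\<alpha> y \<star> \<iota> (z * S p))))" for u b
  proof -
    have "tgt (act A (S (S u)) b) = SD u (\<lambda>p q. \<iota> (S (S q)) \<star> tgt b \<star> \<iota> (S p))"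
      unfolding tgt_act_antipode
      by (rule SD_antipode_arg[of sH "\<lambda>v r. \<iota> (S v) \<star> tgt b \<star> \<iota> r"]; intro smash_lins)
    also have "\<dots> = SD u (\<lambda>p q. SC b (\<lambda>y z. \<iota> (S (S q)) \<star> (\<alpha> y \<star> \<iota> (z * S p))))"
      by (simp add: tgt_def smash_simps)
    finally show ?thesis by (simp only: tsum_swap[of "tensor2 T" "\<Delta> u" "AT A"])
  qed
  then have "SC x (\<lambda>y z. tgt (act A (S (S z)) y))
    = SC x (\<lambda>b u. SC b (\<lambda>y z. SD u (\<lambda>p q. \<iota> (S (S q)) \<star> (\<alpha> y \<star> \<iota> (z * S p)))))" by simp
  also have "\<dots> = SC x (\<lambda>y w. SD w (\<lambda>z u. SD u (\<lambda>p q. \<iota> (S (S q)) \<star> (\<alpha> y \<star> \<iota> (z * S p)))))"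
    by (rule SC_coassoc[of sH]; intro smash_lins)
  also have "\<dots> = SC x (\<lambda>y w. \<iota> (S (S w)) \<star> (\<alpha> y \<star> \<iota> 1))"
  proof -
    have "SD w (\<lambda>z u. SD u (\<lambda>p q. \<iota> (S (S q)) \<star> (\<alpha> y \<star> \<iota> (z * S p))))
      = \<iota> (S (S w)) \<star> (\<alpha> y \<star> \<iota> 1)" for y w
      by (rule SD_antipode_front_right(2)[of sH "\<lambda>z q. \<iota> (S (S q)) \<star> (\<alpha> y \<star> \<iota> z)"]; intro smash_lins)
    then show ?thesis by simp
  qed
  finally show ?thesis by (simp add: tau_incl_A smash_simps)
qed

lemma tau_incl_A_commute: "tau T A (\<alpha> x) \<star> \<alpha> b = \<alpha> b \<star> tau T A (\<alpha> x)"
  unfolding tau_incl_A_tgt smash_tsum tgt_commute ..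

text \<open>The coaction reverses products in \<open>T\<close> and the squared antipode preserves
  them, so the left side is \<open>S (S b1) (tau x) b0\<close>. It remains to move
  \<open>tau x\<close> past \<open>b0\<close>.\<close>

lemma tau_incl_A_mult: "tau T A (\<alpha> (x * b)) = tau T A (\<alpha> b) \<star> tau T A (\<alpha> x)"
proof -
  have "tau T A (\<alpha> (x * b)) = SC x (\<lambda>x0 x1. SC b (\<lambda>b0 b1. \<iota> (S (S (b1 * x1))) \<star> \<alpha> (x0 * b0)))"
    unfolding tau_incl_A by (rule SC_mult[of sH "\<lambda>x y. \<iota> (S (S y)) \<star> \<alpha> x"]; intro smash_lins)
  also have "\<dots> = SC b (\<lambda>b0 b1. SC x (\<lambda>x0 x1. \<iota> (S (S (b1 * x1))) \<star> \<alpha> (x0 * b0)))"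
    by (rule tsum_swap)
  also have "\<dots> = SC b (\<lambda>b0 b1. \<iota> (S (S b1)) \<star> (tau T A (\<alpha> x) \<star> \<alpha> b0))"
    by (simp add: tau_incl_A[of x] smash_simps antipode_mult)
  also have "\<dots> = tau T A (\<alpha> b) \<star> tau T A (\<alpha> x)"
    unfolding tau_incl_A_commute by (simp add: tau_incl_A[of b] smash_simps)
  finally show ?thesis .
qed

lemma tau_mult_incl_A: "tau T A (\<alpha> x \<star> h) = tau T A h \<star> tau T A (\<alpha> x)"
proof (rule AT.lin_eq_on_tens[where f="\<lambda>h. tau T A (\<alpha> x \<star> h)"
      and g="\<lambda>h. tau T A h \<star> tau T A (\<alpha> x)" and sD=sH])
  show "tau T A (\<alpha> x \<star> tens (AT A) b u) = tau T A (tens (AT A) b u) \<star> tau T A (\<alpha> x)" for b u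
    unfolding incl_A_T[symmetric] smash_assoc[symmetric] incl_A_mult tau_incl_A_T tau_incl_A_mult ..
qed (intro smash_lins lin_comp[OF lin_tau])+

text \<open>This is antimultiplicativity for the product of \<open>S w\<close> and \<open>b\<close>.
  Expanding the coaction of \<open>S w2 \<triangleright> b\<close> yields the factor
  \<open>S (S (w1 S w2))\<close>, which cancels; what is left is handled by
  \<open>SD_antipode_act\<close> at \<open>S w\<close>.\<close>

lemma SD_tau_act_antipode:
  "SD (S w) (\<lambda>p q. \<iota> (S q) \<star> tau T A (\<alpha> (act A p b))) = tau T A (\<alpha> b) \<star> \<iota> (S (S w))"
proof -
  \<comment> \<open>The slot \<open>z\<close> will receive \<open>p * S m\<close>, the product that
    is to cancel. Naming the term lets its linearity in each slot be established once.\<close>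
  define K where "K z r n = SC b (\<lambda>x y. \<iota> (S (S (z * y * r))) \<star> \<alpha> (act A (S n) x))" for z r n
  have K_lin: "lin (hscale T) sH (\<lambda>z. K z r n)" "lin (hscale T) sH (\<lambda>r. K z r n)"
    "lin (hscale T) sH (\<lambda>n. K z r n)" for z r n
    unfolding K_def by (intro smash_lins)+
  note K_lins = lin_comp[OF K_lin(1)] lin_comp[OF K_lin(2)] lin_comp[OF K_lin(3)]
  have tau_act: "\<iota> (S (S p)) \<star> tau T A (\<alpha> (act A (S q) b))
    = SD q (\<lambda>v r. SD v (\<lambda>m n. K (p * S m) r n))" for p q
  proof -
    have "tau T A (\<alpha> (act A (S q) b))
      = SD q (\<lambda>v r. SD v (\<lambda>m n. SC b (\<lambda>x y. \<iota> (S (S (S m * y * r))) \<star> \<alpha> (act A (S n) x))))"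
      unfolding tau_incl_A
      by (rule SC_act_antipode[of sH "\<lambda>x y. \<iota> (S (S y)) \<star> \<alpha> x"]; intro smash_lins)
    then show ?thesis by (simp add: K_def smash_simps antipode_mult mult.assoc)
  qed
  have "SD (S w) (\<lambda>p q. \<iota> (S q) \<star> tau T A (\<alpha> (act A p b)))
    = SD w (\<lambda>p q. \<iota> (S (S p)) \<star> tau T A (\<alpha> (act A (S q) b)))"
    by (rule SD_antipode_arg[of sH "\<lambda>p q. \<iota> (S q) \<star> tau T A (\<alpha> (act A p b))"];
        intro smash_lins lin_comp[OF lin_tau])
  also have "\<dots> = SD w (\<lambda>p q. SD q (\<lambda>m u. SD u (\<lambda>n r. K (p * S m) r n)))"
  proof -
    have "SD q (\<lambda>v r. SD v (\<lambda>m n. K (p * S m) r n)) = SD q (\<lambda>m u. SD u (\<lambda>n r. K (p * S m) r n))" for p q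
      by (rule SD_coassoc[of sH]; intro smash_lins K_lins)
    then show ?thesis unfolding tau_act by (simp only:)
  qed
  \<comment> \<open>After the regrouping, \<open>p\<close> and \<open>S m\<close> are adjacent
    Sweedler factors of \<open>w\<close> and reduce to \<open>1\<close>.\<close>
  also have "\<dots> = SD w (\<lambda>n r. K 1 r n)"
    by (rule SD_antipode_front_right(2)[of sH "\<lambda>z u. SD u (\<lambda>n r. K z r n)"]; intro smash_lins K_lins)
  also have "\<dots> = SD w (\<lambda>n r. SC b (\<lambda>x y. \<iota> (S (S y)) \<star> (\<iota> (S (S r)) \<star> \<alpha> (act A (S n) x))))"
    by (simp add: K_def smash_simps antipode_mult)
  also have "\<dots> = SC b (\<lambda>x y. SD w (\<lambda>n r. \<iota> (S (S y)) \<star> (\<iota> (S (S r)) \<star> \<alpha> (act A (S n) x))))"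
    by (rule tsum_swap)
  also have "\<dots> = SC b (\<lambda>x y. \<iota> (S (S y)) \<star> SD w (\<lambda>n r. \<iota> (S (S r)) \<star> \<alpha> (act A (S n) x)))"
    by (simp only: smash_tsum)
  also have "\<dots> = SC b (\<lambda>x y. \<iota> (S (S y)) \<star> (\<alpha> x \<star> \<iota> (S (S w))))"
  proof -
    have "SD w (\<lambda>n r. \<iota> (S (S r)) \<star> \<alpha> (act A (S n) x)) = \<alpha> x \<star> \<iota> (S (S w))" for x
      unfolding SD_antipode_act[symmetric]
      by (rule SD_antipode_arg[of sH "\<lambda>p q. \<iota> (S p) \<star> \<alpha> (act A q x)", symmetric]; intro smash_lins)
    then show ?thesis by simp
  qed
  also have "\<dots> = tau T A (\<alpha> b) \<star> \<iota> (S (S w))"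
    by (simp add: tau_incl_A smash_simps)
  finally show ?thesis .
qed

text \<open>On a pure tensor \<open>b \<sharp> u\<close>, moving \<open>t\<close> past
  \<open>b\<close> lets \<open>S u\<close> be pulled out on the left, which reduces the claim to
  \<open>h\<close> in \<open>A\<close>.\<close>

lemma tau_mult_incl_T:
  assumes "surj S"
  shows "tau T A (\<iota> t \<star> h) = tau T A h \<star> tau T A (\<iota> t)"
proof (rule AT.lin_eq_on_tens[where f="\<lambda>h. tau T A (\<iota> t \<star> h)"
      and g="\<lambda>h. tau T A h \<star> tau T A (\<iota> t)" and sD=sH])
  fix b u
  \<comment> \<open>Surjectivity brings \<open>t\<close> into the form required by
    \<open>SD_tau_act_antipode\<close>.\<close>
  obtain w where w: "t = S w" using assms by (rule surjE)
  have "\<iota> t \<star> tens (AT A) b u = SD t (\<lambda>p q. \<alpha> (act A p b) \<star> \<iota> (q * u))"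
    unfolding incl_A_T[symmetric] smash_assoc[symmetric] incl_T_A by (simp add: smash_simps)
  then have "tau T A (\<iota> t \<star> tens (AT A) b u) = SD t (\<lambda>p q. \<iota> (S (q * u)) \<star> tau T A (\<alpha> (act A p b)))"
    by (simp add: lin_tsum_hom[OF lin_tau] tau_incl_A_T)
  also have "\<dots> = \<iota> (S u) \<star> SD t (\<lambda>p q. \<iota> (S q) \<star> tau T A (\<alpha> (act A p b)))"
    by (simp add: antipode_mult smash_simps)
  also have "\<dots> = tau T A (tens (AT A) b u) \<star> tau T A (\<iota> t)"
    unfolding w SD_tau_act_antipode incl_A_T[symmetric] tau_incl_A_T tau_incl_T smash_assoc ..
  finally show "tau T A (\<iota> t \<star> tens (AT A) b u) = tau T A (tens (AT A) b u) \<star> tau T A (\<iota> t)" .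
qed (intro smash_lins lin_comp[OF lin_tau])+

text \<open>This is the contribution of a coaction generator. Expanding \<open>tau\<close> gives
  \<open>S x2 a S (S x1) x0\<close>, and \<open>incl_A_act\<close> at \<open>S u\<close> recognises
  the first three factors as an action on \<open>a\<close>.\<close>

lemma SC_antipode_tau:
  "SC x (\<lambda>x0 x1. \<iota> (S x1) \<star> \<alpha> a \<star> tau T A (\<alpha> x0)) = \<alpha> (SC x (\<lambda>x0 x1. act A (S x1) a * x0))"
proof -
  have "SC x (\<lambda>x0 x1. \<iota> (S x1) \<star> \<alpha> a \<star> tau T A (\<alpha> x0))
    = SC x (\<lambda>z r. SC z (\<lambda>y p. \<iota> (S r) \<star> (\<alpha> a \<star> (\<iota> (S (S p)) \<star> \<alpha> y))))"
    by (simp add: tau_incl_A smash_simps)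
  also have "\<dots> = SC x (\<lambda>y u. SD u (\<lambda>p r. \<iota> (S r) \<star> (\<alpha> a \<star> (\<iota> (S (S p)) \<star> \<alpha> y))))"
    by (rule SC_coassoc[of sH]; intro smash_lins)
  also have "\<dots> = SC x (\<lambda>y u. \<alpha> (act A (S u) a) \<star> \<alpha> y)"
  proof -
    have "\<alpha> (act A (S u) a) = SD u (\<lambda>p r. \<iota> (S r) \<star> \<alpha> a \<star> \<iota> (S (S p)))" for u
      unfolding incl_A_act
      by (rule SD_antipode_arg[of sH "\<lambda>p q. \<iota> p \<star> \<alpha> a \<star> \<iota> (S q)"]; intro smash_lins)
    then show ?thesis by (simp add: smash_tsum smash_assoc)
  qed
  finally show ?thesis by (simp add: incl_A_mult incl_tsum)
qed

section \<open>Products of distinguished generators\<close>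

context
  fixes HH :: "('k, 'at, 'at, 'hh::ab_group_add) tensor"
  assumes HH: "tensor_product sH sH HH"
begin

interpretation HH: tensor_product sH sH HH by (fact HH)

lemmas HH_lins = smash_lins lin_id[OF HH.target.vector_space_axioms] HH.lin_tsum
  lin_comp[OF lin_tau] lin_comp[OF HH.lin_tens(1)] lin_comp[OF HH.lin_tens(2)] HH.lin_tens

text \<open>The map of the theorem becomes a single sum over \<open>z\<close>, the
  \<open>\<nu>\<close> of the overview.\<close>

lemma smash_mu_tau_tsum:
  "smash_mu T A HH (tensor_map HH HH id (tau T A) z) = tsum HH z (\<lambda>g h. g \<star> tau T A h)"
proof -
  have 1: "tensor_map HH HH id (tau T A) z = tsum HH z (\<lambda>g h. tens HH g (tau T A h))"
    unfolding tensor_map_def id_apply by (rule HH.lift_eq_tsum; intro HH_lins)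
  have 2: "smash_mu T A HH w = tsum HH w (\<lambda>g h. g \<star> h)" for w
    unfolding smash_mu_def by (rule HH.lift_eq_tsum; intro HH_lins)
  have 3: "tsum HH (tens HH g h) (\<lambda>g h. g \<star> h) = g \<star> h" for g h
    by (rule HH.tsum_tens[of sH "\<lambda>g h. g \<star> h"]; intro HH_lins)
  have "tsum HH (tsum HH z (\<lambda>g h. tens HH g (tau T A h))) (\<lambda>g h. g \<star> h)
    = tsum HH z (\<lambda>g h. tsum HH (tens HH g (tau T A h)) (\<lambda>g h. g \<star> h))"
    by (rule HH.tsum_tsum[of sH "\<lambda>g h. g \<star> h"]; intro HH_lins)
  then show ?thesis unfolding 1 2 3 .
qed

abbreviation "\<nu> z \<equiv> tsum HH z (\<lambda>g h. g \<star> tau T A h)"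
abbreviation "HH_mult \<equiv> tensor_mult HH (smash_mult T A) (smash_mult T A)"

lemma lin_nu: "lin (tscale HH) sH (\<lambda>z. \<nu> z)"
  by (intro HH_lins)

lemma nu_tens: "\<nu> (tens HH g h) = g \<star> tau T A h"
  by (rule HH.tsum_tens[of sH "\<lambda>g h. g \<star> tau T A h"]; intro HH_lins)

lemma HH_mult_tsum:
  "HH_mult z w = tsum HH z (\<lambda>x y. tsum HH w (\<lambda>x' y'. tens HH (x \<star> x') (y \<star> y')))"
proof -
  have "tensor_lift HH (tscale HH) (\<lambda>x' y'. tens HH (x \<star> x') (y \<star> y')) w
    = tsum HH w (\<lambda>x' y'. tens HH (x \<star> x') (y \<star> y'))" for x y
    by (rule HH.lift_eq_tsum; (intro HH_lins))
  then show ?thesis unfolding tensor_mult_def by simp (rule HH.lift_eq_tsum; (intro HH_lins))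
qed

lemma lin_HH_mult: "lin (tscale HH) (tscale HH) (\<lambda>z. HH_mult z w)"
  unfolding HH_mult_tsum by (intro HH_lins)

text \<open>Since \<open>tau\<close> reverses the product in the second leg, \<open>x\<close> and
  \<open>tau y\<close> end up on the two outer sides. The hypothesis concerns this \<open>y\<close>
  alone and is supplied separately for each kind of generator.\<close>

lemma nu_mult_tens:
  assumes "\<And>h. tau T A (y \<star> h) = tau T A h \<star> tau T A y"
  shows "\<nu> (HH_mult (tens HH x y) w) = x \<star> \<nu> w \<star> tau T A y"
proof -
  have "HH_mult (tens HH x y) w = tsum HH w (\<lambda>x' y'. tens HH (x \<star> x') (y \<star> y'))"
    unfolding HH_mult_tsum
    by (rule HH.tsum_tens[of "tscale HH" "\<lambda>x y. tsum HH w (\<lambda>x' y'. tens HH (x \<star> x') (y \<star> y'))"];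
        intro HH_lins)
  then show ?thesis
    by (simp add: lin_tsum_hom[OF lin_nu] nu_tens assms smash_tsum smash_assoc)
qed

text \<open>The inductive step: each generator is a pure tensor or a sum of such, so
  \<open>nu_mult_tens\<close> applies termwise.\<close>

lemma nu_mult_generator:
  assumes "surj S" "g \<in> distinguished_generators T A HH" "\<nu> w = \<alpha> a"
  shows "\<nu> (HH_mult g w) \<in> range \<alpha>"
proof -
  note nu_tsum = lin_tsum_hom[OF lin_HH_mult] lin_tsum_hom[OF lin_nu]
  have tau_one: "tau T A (smash_one A) = smash_one A"
    using tau_incl_T[of 1] by (simp add: antipode_one incl_one)
  consider (A) x where "g = tens HH (\<alpha> x) (smash_one A)"
    | (coact) x where "g = tensor_lift (AT A) (tscale HH) (\<lambda>x0 x1. tens HH (\<iota> (S x1)) (\<alpha> x0)) (coact A x)"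
    | (T) t where "g = tensor_map (tensor2 T) HH \<iota> \<iota> (\<Delta> t)"
    using assms(2) unfolding distinguished_generators_def by blast
  then show ?thesis
  proof cases
    case A
    have "\<nu> (HH_mult g w) = \<alpha> x \<star> \<nu> w \<star> tau T A (smash_one A)"
      unfolding A by (rule nu_mult_tens) (simp add: smash_one tau_one)
    then show ?thesis by (simp add: assms(3) tau_one smash_one incl_A_mult)
  next
    case coact
    have "g = SC x (\<lambda>x0 x1. tens HH (\<iota> (S x1)) (\<alpha> x0))"
      unfolding coact by (rule AT.lift_eq_tsum; intro HH_lins)
    then have "\<nu> (HH_mult g w) = SC x (\<lambda>x0 x1. \<iota> (S x1) \<star> \<alpha> a \<star> tau T A (\<alpha> x0))"
      by (simp add: nu_tsum nu_mult_tens tau_mult_incl_A assms(3))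
    then show ?thesis unfolding SC_antipode_tau by simp
  next
    case T
    have "g = SD t (\<lambda>p q. tens HH (\<iota> p) (\<iota> q))"
      unfolding T tensor_map_def by (rule T2.lift_eq_tsum; intro HH_lins)
    then have "\<nu> (HH_mult g w) = SD t (\<lambda>p q. \<iota> p \<star> \<alpha> a \<star> tau T A (\<iota> q))"
      by (simp add: nu_tsum nu_mult_tens tau_mult_incl_T[OF assms(1)] assms(3))
    \<comment> \<open>The sum is \<open>t1 a S t2\<close>, the inner form of
      \<open>t \<triangleright> a\<close>.\<close>
    then show ?thesis unfolding tau_incl_T incl_A_act[symmetric] by simp
  qed
qed

text \<open>\<open>product_in_square\<close> is a right fold, so each new factor stands on the left,
  as \<open>nu_mult_generator\<close> needs. The empty product gives
  \<open>\<alpha> 1\<close>.\<close>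

lemma nu_product:
  assumes "surj S" "set us \<subseteq> distinguished_generators T A HH"
  shows "\<nu> (product_in_square T A HH us) \<in> range \<alpha>"
  using assms(2)
proof (induction us)
  case Nil
  have "\<nu> (product_in_square T A HH []) = \<alpha> 1"
    using tau_incl_T[of 1]
    by (simp add: product_in_square_def nu_tens smash_one antipode_one incl_one)
  then show ?case by simp
next
  case (Cons g us)
  then obtain a where "\<nu> (product_in_square T A HH us) = \<alpha> a" by auto
  then have "\<nu> (HH_mult g (product_in_square T A HH us)) \<in> range \<alpha>"
    using Cons.prems by (intro nu_mult_generator[OF assms(1)]) auto
  then show ?case by (simp add: product_in_square_def)
qed

end

end

theorem lemma4p11:
  fixes T :: "('k::field, 't::{ring, monoid_mult}, 'tt::ab_group_add, 'ttt::ab_group_add) hopf"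
    and A :: "('k, 't, 'a::{ring, monoid_mult}, 'at::ab_group_add, 'att::ab_group_add) yd_data"
    and HH :: "('k, 'at, 'at, 'hh::ab_group_add) tensor"
    and us :: "'hh list" and U :: 'hh
  assumes "hopf_algebra T"
    and "bij (antipode T)"
    and "braided_commutative_yd_module_algebra T A"
    and "tensor_product (tscale (AT A)) (tscale (AT A)) HH"
    and "set us \<subseteq> distinguished_generators T A HH"
    and "U = product_in_square T A HH us"
  shows "smash_mu T A HH (tensor_map HH HH id (tau T A) U) \<in> range (incl_A A)"
proof -
  interpret braided_commutative_yd_module_algebra T A by (fact assms(3))
  show ?thesis unfolding assms(6) smash_mu_tau_tsum[OF assms(4)]
    using nu_product[OF assms(4) bij_is_surj[OF assms(2)] assms(5)] .
qed

end
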